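(* Assume $\lambda_v\le\frac{1}{\sqrt2\Delta-1}$ for all $v\in V$. Then there is a dynamic sampling algorithm for the hardcore model on graphs with maximum degree $\Delta=O(1)$ that, upon updates of $k$ edges and vertices, returns a perfect sample (exactly distributed according to the Gibbs distribution of the updated hardcore model) within $O(\log k)$ rounds and $O(k)$ incremental cost in expectation.
   Context: The hardcore model on a graph $G=(V,E)$ assigns each vertex $v$ a fugacity $\lambda_v>0$; its Gibbs distribution on independent sets $I$ of $G$ is $\mu(I)\propto\prod_{v\in I}\lambda_v$ (equivalently on $\sigma\in\{0,1\}^V$, $\mu(\sigma)\propto\prod_{v:\sigma_v=1}\lambda_v$ if $\{v:\sigma_v=1\}$ is independent and $0$ otherwise). $\Delta$ is the maximum degree of $G$. The dynamic sampling problem: given the current model $\mathcal{I}$, a sample $\boldsymbol{X}\sim\mu_{\mathcal{I}}$, and an update (fixed independently of $\boldsymbol{X}$) of a set of $k$ vertices and edges (addition, deletion, change of fugacities) transforming $\mathcal{I}$ into $\mathcal{I}'$, output a sample exactly distributed as $\mu_{\mathcal{I}'}$. The assumption on $\lambda_v$ refers to the model after the update. Incremental cost is the total number of individual random samplings performed; a round is one parallel iteration. *)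

theory Defs
  imports "HOL-Probability.Probability" "HOL-Library.Landau_Symbols"
begin

section \<open>The hardcore model\<close>

record 'v hardcore =
  verts :: "'v set"
  edges :: "'v set set"
  fugacity :: "'v \<Rightarrow> real"

definition hardcore_model :: "'v hardcore \<Rightarrow> bool" where
  "hardcore_model I \<longleftrightarrow>
     finite (verts I) \<and>
     (\<forall>e\<in>edges I. e \<subseteq> verts I \<and> card e = 2) \<and>
     (\<forall>v\<in>verts I. fugacity I v > 0)"

definition neighbours :: "'v hardcore \<Rightarrow> 'v \<Rightarrow> 'v set" where
  "neighbours I v = {u. {u, v} \<in> edges I}"

definition max_degree :: "'v hardcore \<Rightarrow> nat" where
  "max_degree I = Max (insert 0 ((\<lambda>v. card (neighbours I v)) ` verts I))"

definition independent_sets :: "'v hardcore \<Rightarrow> 'v set set" where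
  "independent_sets I = {S. S \<subseteq> verts I \<and> (\<forall>e\<in>edges I. \<not> e \<subseteq> S)}"

definition weight :: "'v hardcore \<Rightarrow> 'v set \<Rightarrow> real" where
  "weight I S = (if S \<in> independent_sets I then \<Prod>v\<in>S. fugacity I v else 0)"

definition partition_function :: "'v hardcore \<Rightarrow> real" where
  "partition_function I = (\<Sum>S\<in>independent_sets I. weight I S)"

definition gibbs :: "'v hardcore \<Rightarrow> 'v set pmf" where
  "gibbs I = embed_pmf (\<lambda>S. weight I S / partition_function I)"

lemma finite_independent_sets:
  assumes "hardcore_model I"
  shows "finite (independent_sets I)"
  by (rule finite_subset[of _ "Pow (verts I)"])
     (use assms in \<open>auto simp: hardcore_model_def independent_sets_def\<close>)

lemma weight_nonneg:
  assumes "hardcore_model I"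
  shows "weight I S \<ge> 0"
proof -
  have "(\<Prod>v\<in>S. fugacity I v) \<ge> 0" if "S \<subseteq> verts I"
    by (rule prod_nonneg) (use assms that in \<open>force simp: hardcore_model_def\<close>)
  then show ?thesis
    by (simp add: weight_def independent_sets_def)
qed

lemma partition_function_pos:
  assumes "hardcore_model I"
  shows "partition_function I > 0"
proof -
  have "{} \<in> independent_sets I"
    using assms by (auto simp: independent_sets_def hardcore_model_def)
  moreover from this have "weight I {} = 1" by (simp add: weight_def)
  ultimately show ?thesis
    unfolding partition_function_def
    using finite_independent_sets[OF assms] weight_nonneg[OF assms]
    by (intro sum_pos2[of _ "{}"]) auto
qed

lemma pmf_gibbs:
  assumes "hardcore_model I"
  shows "pmf (gibbs I) S = weight I S / partition_function I"
  unfolding gibbs_def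
proof (rule pmf_embed_pmf)
  show "0 \<le> weight I S / partition_function I" for S
    using weight_nonneg[OF assms] partition_function_pos[OF assms] by simp
  have "(\<integral>\<^sup>+ S. ennreal (weight I S / partition_function I) \<partial>count_space UNIV)
      = (\<Sum>S\<in>independent_sets I. ennreal (weight I S / partition_function I))"
    by (rule nn_integral_count_space') (auto simp: weight_def finite_independent_sets[OF assms])
  also have "\<dots> = ennreal (\<Sum>S\<in>independent_sets I. weight I S / partition_function I)"
    using weight_nonneg[OF assms] partition_function_pos[OF assms]
    by (intro sum_ennreal) simp
  also have "(\<Sum>S\<in>independent_sets I. weight I S / partition_function I) = 1"
    using partition_function_pos[OF assms]
    unfolding sum_divide_distrib[symmetric] partition_function_def[symmetric] by simp
  finally show "(\<integral>\<^sup>+ S. ennreal (weight I S / partition_function I) \<partial>count_space UNIV) = 1"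
    by simp
qed


section \<open>Updates\<close>

definition updated_vertices :: "'v hardcore \<Rightarrow> 'v hardcore \<Rightarrow> 'v set" where
  "updated_vertices I I' =
     (verts I - verts I') \<union> (verts I' - verts I) \<union>
     {v \<in> verts I \<inter> verts I'. fugacity I v \<noteq> fugacity I' v}"

definition updated_edges :: "'v hardcore \<Rightarrow> 'v hardcore \<Rightarrow> 'v set set" where
  "updated_edges I I' = (edges I - edges I') \<union> (edges I' - edges I)"

text \<open>The edges lost together with a deleted vertex are counted as updated edges.\<close>

definition update_size :: "'v hardcore \<Rightarrow> 'v hardcore \<Rightarrow> nat" where
  "update_size I I' = card (updated_vertices I I') + card (updated_edges I I')"


section \<open>Dynamic sampling algorithms\<close>

text \<open>
  An algorithm works in synchronous rounds on the updated graph.  Every vertex keeps a current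
  spin, a flag telling whether it performs a random sampling in the next round, and auxiliary
  memory.  In one round each active vertex samples a single bit, independently of the others, and
  then every vertex updates its data deterministically.  The algorithm stops as soon as no vertex
  is active.

  Computation is local: what happens at a vertex in one round may depend only on its closed
  neighbourhood.  Locality is built into the types below, because the functions that make up an
  algorithm only ever receive data restricted to closed neighbourhoods.  Without such a
  restriction, unbounded global computation could replace random samplings, and the number of
  samplings would not measure the cost of an algorithm.
\<close>

record node =
  spin :: bool
  active :: bool
  memory :: nat

definition closed_nbhd :: "'v hardcore \<Rightarrow> 'v \<Rightarrow> 'v set" where
  "closed_nbhd I v = insert v (neighbours I v)"

record 'v local_view =
  centre :: 'v
  adjacent :: "'v set"
  local_fugacity :: "'v \<Rightarrow> real"

definition view :: "'v hardcore \<Rightarrow> 'v \<Rightarrow> 'v local_view" where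
  "view I v = \<lparr>centre = v, adjacent = neighbours I v,
               local_fugacity = restrict (fugacity I) (closed_nbhd I v)\<rparr>"

text \<open>
  \<open>start\<close> receives the view before the update together with the part of the old sample that is
  visible there (\<open>None\<close> for a vertex that has just been added), and the view after the update.
  \<open>draw\<close> is the law of the bit sampled by an active vertex.  \<open>step\<close> receives the old data and
  the sampled bits in the neighbourhood.
\<close>

record 'v algorithm =
  start :: "('v local_view \<times> ('v \<Rightarrow> bool)) option \<Rightarrow> 'v local_view \<Rightarrow> node"
  draw :: "'v local_view \<Rightarrow> ('v \<Rightarrow> node) \<Rightarrow> bool pmf"
  step :: "'v local_view \<Rightarrow> ('v \<Rightarrow> node) \<Rightarrow> ('v \<Rightarrow> bool) \<Rightarrow> node"

definition initial_config ::
    "'v algorithm \<Rightarrow> 'v hardcore \<Rightarrow> 'v hardcore \<Rightarrow> 'v set \<Rightarrow> 'v \<Rightarrow> node" where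
  "initial_config A I I' X =
     (\<lambda>v\<in>verts I'. start A
        (if v \<in> verts I then Some (view I v, restrict (\<lambda>u. u \<in> X) (closed_nbhd I v)) else None)
        (view I' v))"

definition active_set :: "'v hardcore \<Rightarrow> ('v \<Rightarrow> node) \<Rightarrow> 'v set" where
  "active_set I s = {v \<in> verts I. active (s v)}"

definition samplings :: "'v algorithm \<Rightarrow> 'v hardcore \<Rightarrow> ('v \<Rightarrow> node) \<Rightarrow> ('v \<Rightarrow> bool) pmf" where
  "samplings A I s =
     Pi_pmf (active_set I s) False (\<lambda>v. draw A (view I v) (restrict s (closed_nbhd I v)))"

definition next_config ::
    "'v algorithm \<Rightarrow> 'v hardcore \<Rightarrow> ('v \<Rightarrow> node) \<Rightarrow> ('v \<Rightarrow> bool) \<Rightarrow> 'v \<Rightarrow> node" where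
  "next_config A I s b =
     (\<lambda>v\<in>verts I. step A (view I v)
        (restrict s (closed_nbhd I v))
        (restrict b (closed_nbhd I v \<inter> active_set I s)))"

definition occupied :: "'v hardcore \<Rightarrow> ('v \<Rightarrow> node) \<Rightarrow> 'v set" where
  "occupied I s = {v \<in> verts I. spin (s v)}"

text \<open>
  \<open>run A I s t c\<close> continues from configuration \<open>s\<close> after \<open>t\<close> rounds and \<open>c\<close> individual samplings.
  The result is the joint law of output, total number of rounds and total number of samplings;
  nontermination accounts for the mass missing from this subprobability distribution.
\<close>

partial_function (spmf) run ::
    "'v algorithm \<Rightarrow> 'v hardcore \<Rightarrow> ('v \<Rightarrow> node) \<Rightarrow> nat \<Rightarrow> nat \<Rightarrow> ('v set \<times> nat \<times> nat) spmf" where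
  "run A I s t c =
     (if active_set I s = {} then return_spmf (occupied I s, t, c)
      else bind_spmf (spmf_of_pmf (samplings A I s))
             (\<lambda>b. run A I (next_config A I s b) (t + 1) (c + card (active_set I s))))"

definition dynamic_sample ::
    "'v algorithm \<Rightarrow> 'v hardcore \<Rightarrow> 'v hardcore \<Rightarrow> ('v set \<times> nat \<times> nat) spmf" where
  "dynamic_sample A I I' =
     bind_spmf (spmf_of_pmf (gibbs I)) (\<lambda>X. run A I' (initial_config A I I' X) 0 0)"

text \<open>The equation between subprobability distributions includes almost sure termination.\<close>

definition returns_perfect_sample ::
    "'v algorithm \<Rightarrow> 'v hardcore \<Rightarrow> 'v hardcore \<Rightarrow> bool" where
  "returns_perfect_sample A I I' \<longleftrightarrow>
     map_spmf fst (dynamic_sample A I I') = spmf_of_pmf (gibbs I')"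

definition expected_rounds :: "'v algorithm \<Rightarrow> 'v hardcore \<Rightarrow> 'v hardcore \<Rightarrow> ennreal" where
  "expected_rounds A I I' =
     (\<integral>\<^sup>+ (S, t, c). of_nat t \<partial>measure_spmf (dynamic_sample A I I'))"

definition expected_cost :: "'v algorithm \<Rightarrow> 'v hardcore \<Rightarrow> 'v hardcore \<Rightarrow> ennreal" where
  "expected_cost A I I' =
     (\<integral>\<^sup>+ (S, t, c). of_nat c \<partial>measure_spmf (dynamic_sample A I I'))"

end

theory Submission
  imports Defs
begin

text \<open>
  Rejection sampling confined to a region \<open>W\<close>.  The invariant is that the configuration off \<open>W\<close> is a
  Gibbs sample of the graph with \<open>W\<close> removed.  Resampling all spins in \<open>W\<close> independently, with
  occupation probability \<open>\<lambda>\<^sub>v / (1 + \<lambda>\<^sub>v)\<close>, may violate edges; let \<open>B\<close> be the set of endpoints of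
  violated edges.  Given \<open>B\<close>, all of \<open>B\<close> is occupied, its other neighbours are vacant, and the
  configuration off the closed neighbourhood of \<open>B\<close> is again a Gibbs sample, so this neighbourhood
  is the next \<open>W\<close> and the whole configuration is an exact sample once \<open>B\<close> is empty.

  The occupation probabilities are at most \<open>1 / (\<surd>2 \<Delta>)\<close>, so an edge meeting \<open>W\<close> is violated with
  probability at most \<open>1 / (2 \<Delta>\<^sup>2)\<close> and then contributes at most \<open>2 \<Delta>\<close> vertices to the next
  region.  A union of closed neighbourhoods meets at most \<open>(\<Delta> - 1/2) |W|\<close> edges, because every
  vertex in it has an edge inside it.  Hence the expected size of the region shrinks by the factor
  \<open>1 - 1 / (2 \<Delta>)\<close> in each step, which gives linear cost and logarithmically many rounds.
\<close>

section \<open>Subprobability distributions\<close>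

text \<open>Both sides have total mass 1, which forces \<open>k = 1\<close>; conditional laws can
  thus be identified without evaluating their normalising constants.\<close>

lemma pmf_eqI_proportional:
  assumes "\<And>x. pmf p x = k * pmf q x"
  shows "p = q"
proof -
  obtain y where "pmf p y > 0"
    using set_pmf_not_empty[of p] by (auto simp: set_pmf_eq')
  moreover have "0 \<le> pmf q y" by simp
  ultimately have k: "k \<ge> 0"
    using assms[of y] by (metis less_le_not_le linorder_linear mult_nonpos_nonneg)
  have "1 = (\<integral>\<^sup>+ x. pmf p x \<partial>count_space UNIV)"
    by (simp add: nn_integral_pmf measure_pmf.emeasure_space_1[simplified])
  also have "\<dots> = (\<integral>\<^sup>+ x. ennreal k * pmf q x \<partial>count_space UNIV)"
    using k by (simp add: assms ennreal_mult)
  also have "\<dots> = ennreal k"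
    by (simp add: nn_integral_cmult nn_integral_pmf measure_pmf.emeasure_space_1[simplified])
  finally have "k = 1" using k by simp
  then show ?thesis using assms by (intro pmf_eqI) simp
qed

text \<open>Law of total probability along the fibres of \<open>f\<close>.\<close>

lemma bind_cond_pmf_map:
  "bind_pmf (map_pmf f p) (\<lambda>b. cond_pmf p {x. f x = b}) = p"
proof -
  have "bind_pmf (map_pmf f p) (\<lambda>b. cond_pmf p {x. b = f x}) = p"
  proof (rule bind_cond_pmf_cancel)
    fix b assume "b \<in> set_pmf (map_pmf f p)"
    then show "set_pmf p \<inter> {x. b = f x} \<noteq> {}" by auto
  next
    fix y assume "y \<in> set_pmf p"
    then show "set_pmf (map_pmf f p) \<inter> {b. b = f y} \<noteq> {}" by auto
  next
    fix b y assume "b = f y"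
    then show "measure (measure_pmf p) {y. b = f y}
        = measure (measure_pmf (map_pmf f p)) {b. b = f y}"
      by (simp add: vimage_def eq_commute[of "f y"])
  qed
  moreover have "{x. b = f x} = {x. f x = b}" for b by auto
  ultimately show ?thesis by simp
qed

lemma nn_integral_measure_spmf_bind_pmf:
  "(\<integral>\<^sup>+ y. f y \<partial>measure_spmf (bind_pmf p q))
     = (\<integral>\<^sup>+ x. (\<integral>\<^sup>+ y. f y \<partial>measure_spmf (q x)) \<partial>measure_pmf p)"
proof -
  have "measure_spmf (bind_pmf p q) = measure_pmf p \<bind> (\<lambda>x. measure_spmf (q x))"
    using measure_spmf_bind[of "spmf_of_pmf p" q] by (simp add: o_def)
  then show ?thesis
    by (simp add: nn_integral_bind[where B = "count_space UNIV"] space_measure_spmf)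
qed

text \<open>Domination leaves \<open>p\<close> no mass to lose: its weight is 1, and two laws of
  mass 1 that are ordered pointwise agree. A one-sided bound thus yields exactness and almost sure
  termination together.\<close>

lemma spmf_eq_spmf_of_pmfI:
  assumes "\<And>x. pmf q x \<le> spmf p x"
  shows "p = spmf_of_pmf q"
proof -
  have "1 = (\<integral>\<^sup>+ x. pmf q x \<partial>count_space UNIV)"
    by (simp add: nn_integral_pmf measure_pmf.emeasure_space_1[simplified])
  also have "\<dots> \<le> (\<integral>\<^sup>+ x. spmf p x \<partial>count_space UNIV)"
    by (intro nn_integral_mono) (simp add: assms)
  also have "\<dots> = ennreal (weight_spmf p)"
    by (simp add: nn_integral_spmf measure_spmf.emeasure_eq_measure space_measure_spmf)
  finally have "1 \<le> weight_spmf p" by simp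
  then have "weight_spmf p = 1"
    using weight_spmf_le_1[of p] by linarith
  then obtain p' where p': "p = spmf_of_pmf p'"
    by (auto simp: lossless_spmf_def[symmetric] lossless_spmf_conv_spmf_of_pmf)
  have le: "pmf q x \<le> pmf p' x" for x using assms[of x] by (simp add: p')
  have "pmf q x = pmf p' x" for x
  proof (rule ccontr)
    assume "pmf q x \<noteq> pmf p' x"
    with le[of x] have less: "pmf q x < pmf p' x" by simp
    have "1 = (\<integral>\<^sup>+ y. pmf q y \<partial>count_space UNIV)"
      by (simp add: nn_integral_pmf measure_pmf.emeasure_space_1[simplified])
    also have "\<dots> < (\<integral>\<^sup>+ y. pmf p' y \<partial>count_space UNIV)"
    proof (rule nn_integral_less)
      show "(\<integral>\<^sup>+ y. pmf q y \<partial>count_space UNIV) \<noteq> \<infinity>"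
        by (simp add: nn_integral_pmf measure_pmf.emeasure_space_1[simplified])
      show "\<not> (AE y in count_space UNIV. ennreal (pmf p' y) \<le> ennreal (pmf q y))"
        using less by (auto simp: AE_count_space not_le intro!: exI[of _ x])
    qed (auto simp: le AE_count_space)
    also have "\<dots> = 1"
      by (simp add: nn_integral_pmf measure_pmf.emeasure_space_1[simplified])
    finally show False by simp
  qed
  then have "q = p'" by (rule pmf_eqI)
  then show ?thesis by (simp add: p')
qed

section \<open>Gibbs distributions of induced subgraphs\<close>

text \<open>Its Gibbs distribution is that of \<open>I\<close> conditioned on \<open>W\<close> being
  vacant.\<close>

definition remove_vertices :: "'v hardcore \<Rightarrow> 'v set \<Rightarrow> 'v hardcore" where
  "remove_vertices I W = I\<lparr>verts := verts I - W, edges := {e \<in> edges I. e \<inter> W = {}}\<rparr>"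

definition nbhd_closure :: "'v hardcore \<Rightarrow> 'v set \<Rightarrow> 'v set" where
  "nbhd_closure I B = (\<Union>v\<in>B. closed_nbhd I v)"

definition conflicts :: "'v hardcore \<Rightarrow> 'v set \<Rightarrow> 'v set" where
  "conflicts I X = {v \<in> X. \<exists>u\<in>X. u \<in> neighbours I v}"

lemma remove_vertices_empty [simp]: "remove_vertices I {} = I"
  by (simp add: remove_vertices_def)

lemma nbhd_closure_empty [simp]: "nbhd_closure I {} = {}"
  by (simp add: nbhd_closure_def)

lemma hardcore_model_remove_vertices:
  "hardcore_model I \<Longrightarrow> hardcore_model (remove_vertices I W)"
  by (auto simp: hardcore_model_def remove_vertices_def)

lemma neighbours_sym: "u \<in> neighbours I v \<longleftrightarrow> v \<in> neighbours I u"
  by (simp add: neighbours_def insert_commute)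

lemma neighboursD:
  assumes "hardcore_model I" "u \<in> neighbours I v"
  shows "u \<in> verts I" "v \<in> verts I" "u \<noteq> v"
  using assms by (fastforce simp: hardcore_model_def neighbours_def)+

lemma finite_neighbours: "hardcore_model I \<Longrightarrow> finite (neighbours I v)"
  by (rule finite_subset[of _ "verts I"]) (auto dest: neighboursD, simp add: hardcore_model_def)

lemma edge_obtain:
  assumes "hardcore_model I" "e \<in> edges I"
  obtains u v where "e = {u, v}" "u \<noteq> v" "u \<in> verts I" "v \<in> verts I" "u \<in> neighbours I v"
proof -
  have "card e = 2" "e \<subseteq> verts I" using assms by (auto simp: hardcore_model_def)
  then obtain u v where "e = {u, v}" "u \<noteq> v" by (auto simp: card_2_iff)
  then show thesis using that assms \<open>e \<subseteq> verts I\<close> by (auto simp: neighbours_def)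
qed

lemma independent_iff:
  assumes "hardcore_model I"
  shows "S \<in> independent_sets I \<longleftrightarrow> S \<subseteq> verts I \<and> (\<forall>v\<in>S. \<forall>u\<in>S. u \<notin> neighbours I v)"
  unfolding independent_sets_def
  by (auto elim!: edge_obtain[OF assms]) (auto simp: neighbours_def)

lemma neighbours_remove_vertices:
  "neighbours (remove_vertices I W) v = (if v \<in> W then {} else neighbours I v - W)"
  by (auto simp: neighbours_def remove_vertices_def)

lemma independent_remove_vertices_iff:
  assumes "hardcore_model I"
  shows "S \<in> independent_sets (remove_vertices I W) \<longleftrightarrow>
    S \<subseteq> verts I - W \<and> (\<forall>v\<in>S. \<forall>u\<in>S. u \<notin> neighbours I v)"
  by (subst independent_iff[OF hardcore_model_remove_vertices[OF assms]])
     (auto simp: neighbours_remove_vertices, auto simp: remove_vertices_def)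

lemma set_pmf_gibbs_subset:
  assumes "hardcore_model I"
  shows "set_pmf (gibbs I) \<subseteq> independent_sets I"
  by (auto simp: set_pmf_eq pmf_gibbs[OF assms] weight_def)

text \<open>On a fibre of \<open>f\<close> the configurations are \<open>f X\<close> plus an
  arbitrary independent set of a smaller graph. The product weight splits accordingly, so
  conditioning on \<open>f\<close> leaves a Gibbs sample there. The weights \<open>lam\<close> are
  kept apart from \<open>fugacity I\<close> because the law may come from an older model that agrees
  with \<open>I\<close> only on the free vertices.\<close>

lemma pmf_disintegration:
  fixes I :: "'v hardcore"
  assumes I: "hardcore_model I"
    and pmf: "\<And>X. pmf p X = (if X \<in> Q then c * (\<Prod>v\<in>X. lam v) else 0)"
    and fin: "\<And>X. X \<in> Q \<Longrightarrow> finite X"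
    and fibre: "\<And>X. X \<in> Q \<Longrightarrow> {X' \<in> Q. f X' = f X} =
                  (\<lambda>Y. f X \<union> Y) ` independent_sets (remove_vertices I (N (f X)))"
    and disj: "\<And>X. X \<in> Q \<Longrightarrow> f X \<inter> (verts I - N (f X)) = {}"
    and lam: "\<And>X v. X \<in> Q \<Longrightarrow> v \<in> verts I - N (f X) \<Longrightarrow> lam v = fugacity I v"
  shows "p = bind_pmf (map_pmf f p) (\<lambda>b. map_pmf (\<lambda>Y. b \<union> Y) (gibbs (remove_vertices I (N b))))"
proof -
  have "cond_pmf p {x. f x = b} = map_pmf (\<lambda>Y. b \<union> Y) (gibbs (remove_vertices I (N b)))"
    if b: "b \<in> f ` set_pmf p" for b
  proof (rule pmf_eqI_proportional)
    from b obtain X where X: "X \<in> set_pmf p" "b = f X" by auto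
    then have XQ: "X \<in> Q" by (auto simp: set_pmf_eq pmf split: if_splits)
    define G where "G = remove_vertices I (N b)"
    define m where "m = measure (measure_pmf p) {x. f x = b}"
    have G: "hardcore_model G" unfolding G_def by (rule hardcore_model_remove_vertices[OF I])
    have ne: "set_pmf p \<inter> {x. f x = b} \<noteq> {}" using X by auto
    have fib: "{X' \<in> Q. f X' = b} = (\<lambda>Y. b \<union> Y) ` independent_sets G"
      using fibre[OF XQ] by (simp add: G_def X)
    \<comment> \<open>The empty set is independent, so \<open>b\<close> itself lies in the fibre and
      hence in \<open>Q\<close>; this makes \<open>b\<close> finite.\<close>
    have "b \<union> {} \<in> {X' \<in> Q. f X' = b}"
      unfolding fib by (intro imageI) (simp add: independent_iff[OF G])
    then have finb: "finite b" using fin by auto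
    have Y: "Y \<subseteq> verts I - N b" "Y \<inter> b = {}" if "Y \<in> independent_sets G" for Y
      using that disj[OF XQ] by (auto simp: G_def X independent_remove_vertices_iff[OF I])
    have inj: "inj_on (\<lambda>Y. b \<union> Y) (independent_sets G)"
      using Y(2) by (intro inj_onI) blast
    have pmf_G: "pmf (map_pmf (\<lambda>Y. b \<union> Y) (gibbs G)) (b \<union> Y) = pmf (gibbs G) Y"
      if "Y \<in> independent_sets G" for Y
    proof -
      have "pmf (map_pmf (\<lambda>Y. b \<union> Y) (gibbs G)) (b \<union> Y)
          = measure (measure_pmf (gibbs G)) ((\<lambda>Y. b \<union> Y) -` {b \<union> Y})"
        by (simp add: pmf_map)
      \<comment> \<open>Adding \<open>b\<close> is injective on the independent sets of
        \<open>G\<close>, which carry all of the Gibbs mass.\<close>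
      also have "\<dots> = measure (measure_pmf (gibbs G)) {Y}"
        by (rule measure_pmf.finite_measure_eq_AE)
           (use set_pmf_gibbs_subset[OF G] inj_onD[OF inj] that in
             \<open>auto simp: AE_measure_pmf_iff subset_iff\<close>)
      finally show ?thesis by (simp add: pmf.rep_eq)
    qed
    fix x
    \<comment> \<open>The factor collects everything constant on the fibre: the weight of
      \<open>b\<close>, the normalisers and the mass of the fibre.\<close>
    show "pmf (cond_pmf p {x. f x = b}) x =
       (c * (\<Prod>v\<in>b. lam v) * partition_function G / m) *
         pmf (map_pmf (\<lambda>Y. b \<union> Y) (gibbs (remove_vertices I (N b)))) x"
    proof (cases "x \<in> Q \<and> f x = b")
      case True
      then have "x \<in> (\<lambda>Y. b \<union> Y) ` independent_sets G" unfolding fib[symmetric] by simp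
      then obtain Y where YG: "Y \<in> independent_sets G" "x = b \<union> Y" by auto
      have finY: "finite Y" using fin[of x] True YG by simp
      have "(\<Prod>v\<in>x. lam v) = (\<Prod>v\<in>b. lam v) * (\<Prod>v\<in>Y. lam v)"
        unfolding YG(2) using finb finY Y(2)[OF YG(1)] by (intro prod.union_disjoint) auto
      also have "(\<Prod>v\<in>Y. lam v) = (\<Prod>v\<in>Y. fugacity G v)"
        using Y(1)[OF YG(1)] lam[OF XQ] X
        by (intro prod.cong) (auto simp: G_def remove_vertices_def)
      finally have "(\<Prod>v\<in>x. lam v) = (\<Prod>v\<in>b. lam v) * weight G Y"
        using YG(1) by (simp add: weight_def)
      moreover have "pmf (map_pmf (\<lambda>Y. b \<union> Y) (gibbs G)) x = weight G Y / partition_function G"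
        unfolding YG(2) pmf_G[OF YG(1)] by (rule pmf_gibbs[OF G])
      ultimately show ?thesis
        using True partition_function_pos[OF G]
        by (simp add: pmf_cond[OF ne] pmf m_def G_def[symmetric])
    next
      case False
      then have "x \<notin> (\<lambda>Y. b \<union> Y) ` set_pmf (gibbs G)"
        using set_pmf_gibbs_subset[OF G] fib by blast
      then have "pmf (map_pmf (\<lambda>Y. b \<union> Y) (gibbs G)) x = 0" by (rule pmf_map_outside)
      then show ?thesis using False by (auto simp: pmf_cond[OF ne] pmf G_def)
    qed
  qed
  then have "bind_pmf (map_pmf f p) (\<lambda>b. map_pmf (\<lambda>Y. b \<union> Y) (gibbs (remove_vertices I (N b))))
      = bind_pmf (map_pmf f p) (\<lambda>b. cond_pmf p {x. f x = b})"
    by (intro bind_pmf_cong) auto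
  then show ?thesis by (simp add: bind_cond_pmf_map)
qed

section \<open>Resampling\<close>

text \<open>The Gibbs probability that an isolated vertex with this fugacity is occupied.\<close>

definition occupation_prob :: "'v hardcore \<Rightarrow> 'v \<Rightarrow> real" where
  "occupation_prob I v = fugacity I v / (1 + fugacity I v)"

definition resampled :: "'v hardcore \<Rightarrow> 'v set \<Rightarrow> 'v set pmf" where
  "resampled I W = bind_pmf (gibbs (remove_vertices I W)) (\<lambda>Y.
     map_pmf (\<lambda>b. Y \<union> {v. b v}) (Pi_pmf W False (\<lambda>v. bernoulli_pmf (occupation_prob I v))))"

definition next_conflicts :: "'v hardcore \<Rightarrow> 'v set \<Rightarrow> 'v set pmf" where
  "next_conflicts I W = map_pmf (conflicts I) (resampled I W)"

definition conflict_free_off :: "'v hardcore \<Rightarrow> 'v set \<Rightarrow> 'v set set" where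
  "conflict_free_off I W = {X. X \<subseteq> verts I \<and> (\<forall>v\<in>X - W. \<forall>u\<in>X - W. u \<notin> neighbours I v)}"

lemma occupation_prob_bounds:
  assumes "hardcore_model I" "v \<in> verts I"
  shows "0 < occupation_prob I v" "occupation_prob I v < 1"
  using assms by (auto simp: occupation_prob_def hardcore_model_def)

text \<open>A vertex of \<open>W\<close> is occupied with odds \<open>fugacity I v\<close>, so the
  product weight extends over \<open>W\<close>. The result is the Gibbs distribution of the graph in
  which the edges meeting \<open>W\<close> are dropped and their endpoints kept.\<close>

lemma pmf_resampled:
  assumes I: "hardcore_model I" and W: "W \<subseteq> verts I"
  shows "pmf (resampled I W) X =
    (if X \<in> conflict_free_off I W
     then 1 / (partition_function (remove_vertices I W) * (\<Prod>v\<in>W. 1 + fugacity I v)) *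
            (\<Prod>v\<in>X. fugacity I v) else 0)"
proof -
  define G where "G = remove_vertices I W"
  define P where "P = Pi_pmf W False (\<lambda>v. bernoulli_pmf (occupation_prob I v))"
  define f where "f = (\<lambda>(Y :: 'a set, b). Y \<union> {v. b v})"
  have G: "hardcore_model G" unfolding G_def by (rule hardcore_model_remove_vertices[OF I])
  have finV: "finite (verts I)" using I by (simp add: hardcore_model_def)
  have finW: "finite W" using finite_subset[OF W finV] .
  have J: "resampled I W = map_pmf f (pair_pmf (gibbs G) P)"
    by (simp add: resampled_def f_def G_def P_def pair_pmf_def map_pmf_def bind_assoc_pmf
        bind_return_pmf)
  have supp: "Y \<subseteq> verts I - W \<and> (\<forall>v\<in>Y. \<forall>u\<in>Y. u \<notin> neighbours I v) \<and> {v. b v} \<subseteq> W"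
    if "(Y, b) \<in> set_pmf (pair_pmf (gibbs G) P)" for Y b
  proof -
    have "Y \<in> independent_sets G" "b \<in> set_pmf P"
      using that set_pmf_gibbs_subset[OF G] by auto
    moreover have "b \<in> PiE_dflt W False (\<lambda>v. set_pmf (bernoulli_pmf (occupation_prob I v)))"
      using \<open>b \<in> set_pmf P\<close> set_Pi_pmf_subset'[OF finW, of False "\<lambda>v. bernoulli_pmf (occupation_prob I v)"]
      unfolding P_def o_def by blast
    ultimately show ?thesis
      by (auto simp: G_def independent_remove_vertices_iff[OF I] PiE_dflt_def)
  qed
  show ?thesis
  proof (cases "X \<in> conflict_free_off I W")
    case True
    \<comment> \<open>The preimage of \<open>X\<close> meets the support in a single pair, because
      the Gibbs part avoids \<open>W\<close> and the bits live on \<open>W\<close>.\<close>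
    define b where "b = (\<lambda>v. v \<in> X \<inter> W)"
    have X: "X = f (X - W, b)" by (auto simp: f_def b_def)
    have XW: "X - W \<in> independent_sets G"
      using True by (auto simp: G_def independent_remove_vertices_iff[OF I] conflict_free_off_def)
    have finX: "finite X"
      using True finite_subset[OF _ finV] by (auto simp: conflict_free_off_def)
    have "pmf (resampled I W) X = measure (measure_pmf (pair_pmf (gibbs G) P)) (f -` {X})"
      by (simp add: J pmf_map)
    also have "\<dots> = measure (measure_pmf (pair_pmf (gibbs G) P)) {(X - W, b)}"
    proof (rule measure_pmf.finite_measure_eq_AE)
      show "AE x in measure_pmf (pair_pmf (gibbs G) P). (x \<in> f -` {X}) = (x \<in> {(X - W, b)})"
      proof (unfold AE_measure_pmf_iff, intro ballI)
        fix x assume x: "x \<in> set_pmf (pair_pmf (gibbs G) P)"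
        obtain Y b' where x': "x = (Y, b')" by (cases x)
        note s = supp[OF x[unfolded x']]
        show "(x \<in> f -` {X}) = (x \<in> {(X - W, b)})"
        proof
          assume "x \<in> f -` {X}"
          then have "X = Y \<union> {v. b' v}" by (auto simp: x' f_def)
          with s have "Y = X - W" "b' v = b v" for v by (auto simp: b_def)
          then show "x \<in> {(X - W, b)}" by (auto simp: x')
        qed (use X in auto)
      qed
    qed simp_all
    also have "\<dots> = pmf (gibbs G) (X - W) * pmf P b"
      by (simp add: measure_pmf_single pmf_pair)
    also have "pmf P b = (\<Prod>v\<in>W. pmf (bernoulli_pmf (occupation_prob I v)) (b v))"
      unfolding P_def by (subst pmf_Pi'[OF finW]) (auto simp: b_def)
    also have "\<dots> = (\<Prod>v\<in>W. (if v \<in> X then fugacity I v else 1) / (1 + fugacity I v))"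
    proof (rule prod.cong)
      fix v assume "v \<in> W"
      then have "v \<in> verts I" using W by auto
      then have pos: "fugacity I v > 0" using I by (simp add: hardcore_model_def)
      show "pmf (bernoulli_pmf (occupation_prob I v)) (b v)
          = (if v \<in> X then fugacity I v else 1) / (1 + fugacity I v)"
        using occupation_prob_bounds[OF I \<open>v \<in> verts I\<close>] pos \<open>v \<in> W\<close>
        by (cases "v \<in> X") (auto simp: b_def occupation_prob_def field_simps)
    qed simp
    also have "\<dots> = (\<Prod>v\<in>X \<inter> W. fugacity I v) / (\<Prod>v\<in>W. 1 + fugacity I v)"
      by (simp add: prod_dividef prod.If_cases finW Int_commute)
    also have "pmf (gibbs G) (X - W) = (\<Prod>v\<in>X - W. fugacity I v) / partition_function G"
      using XW by (simp add: pmf_gibbs[OF G] weight_def) (simp add: G_def remove_vertices_def)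
    also have "(\<Prod>v\<in>X - W. fugacity I v) / partition_function G *
        ((\<Prod>v\<in>X \<inter> W. fugacity I v) / (\<Prod>v\<in>W. 1 + fugacity I v)) =
        1 / (partition_function G * (\<Prod>v\<in>W. 1 + fugacity I v)) *
          ((\<Prod>v\<in>X \<inter> W. fugacity I v) * (\<Prod>v\<in>X - W. fugacity I v))"
      by (simp add: field_simps)
    also have "(\<Prod>v\<in>X \<inter> W. fugacity I v) * (\<Prod>v\<in>X - W. fugacity I v) = (\<Prod>v\<in>X. fugacity I v)"
      using finX by (subst prod.union_disjoint[symmetric]) (auto intro!: prod.cong)
    finally show ?thesis using True by (simp add: G_def)
  next
    case False
    have "X \<notin> f ` set_pmf (pair_pmf (gibbs G) P)"
    proof
      assume "X \<in> f ` set_pmf (pair_pmf (gibbs G) P)"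
      then obtain Y b where Yb: "(Y, b) \<in> set_pmf (pair_pmf (gibbs G) P)" "X = Y \<union> {v. b v}"
        by (auto simp: f_def)
      from supp[OF Yb(1)] Yb(2) W have "X \<in> conflict_free_off I W"
        unfolding conflict_free_off_def by blast
      with False show False by simp
    qed
    then show ?thesis using False by (simp add: J pmf_map_outside)
  qed
qed

lemma set_pmf_resampled_subset:
  assumes "hardcore_model I" "W \<subseteq> verts I"
  shows "set_pmf (resampled I W) \<subseteq> conflict_free_off I W"
  by (auto simp: set_pmf_eq pmf_resampled[OF assms])

text \<open>No vertex of \<open>Y\<close> is adjacent to \<open>B\<close>, and every vertex of
  \<open>B\<close> has its conflicting partner in \<open>B\<close>.\<close>

lemma conflicts_union_independent:
  assumes I: "hardcore_model I" and B: "conflicts I X = B"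
    and Y: "Y \<in> independent_sets (remove_vertices I (nbhd_closure I B))"
  shows "conflicts I (B \<union> Y) = B"
proof -
  have 1: "\<exists>u\<in>B. u \<in> neighbours I v" if "v \<in> B" for v
    using that neighbours_sym unfolding B[symmetric] conflicts_def by fastforce
  have 2: "u \<notin> neighbours I v" if "v \<in> Y" "u \<in> B \<union> Y" for u v
    using Y that neighbours_sym[of u I v] unfolding independent_remove_vertices_iff[OF I]
    by (auto simp: nbhd_closure_def closed_nbhd_def)
  show ?thesis
    unfolding conflicts_def using 1 2 by blast
qed

text \<open>Knowing that the conflict set is \<open>B\<close> forces its neighbours outside
  \<open>B\<close> to be vacant, since an occupied one would itself be in conflict. Apart from this,
  the rest may be any independent set.\<close>

lemma resampled_disintegration:
  assumes I: "hardcore_model I" and W: "W \<subseteq> verts I"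
  shows "resampled I W = bind_pmf (next_conflicts I W)
    (\<lambda>B. map_pmf (\<lambda>Y. B \<union> Y) (gibbs (remove_vertices I (nbhd_closure I B))))"
  unfolding next_conflicts_def
proof (rule pmf_disintegration[OF I pmf_resampled[OF I W]])
  show "finite X" if "X \<in> conflict_free_off I W" for X
    using that I by (auto simp: conflict_free_off_def hardcore_model_def intro: finite_subset)
  show "{X' \<in> conflict_free_off I W. conflicts I X' = conflicts I X} =
     (\<lambda>Y. conflicts I X \<union> Y) `
       independent_sets (remove_vertices I (nbhd_closure I (conflicts I X)))"
    if X: "X \<in> conflict_free_off I W" for X
  proof (intro equalityI subsetI)
    let ?B = "conflicts I X"
    fix X' assume X': "X' \<in> {X' \<in> conflict_free_off I W. conflicts I X' = ?B}"
    have B: "?B = {v \<in> X'. \<exists>u\<in>X'. u \<in> neighbours I v}"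
      using X' by (auto simp: conflicts_def)
    have "X' - ?B \<in> independent_sets (remove_vertices I (nbhd_closure I ?B))"
      unfolding independent_remove_vertices_iff[OF I]
    proof (intro conjI subsetI ballI)
      fix v assume v: "v \<in> X' - ?B"
      have "v \<in> verts I" using v X' by (auto simp: conflict_free_off_def)
      moreover have "v \<notin> nbhd_closure I ?B"
        using v B by (auto simp: nbhd_closure_def closed_nbhd_def neighbours_sym[of v])
      ultimately show "v \<in> verts I - nbhd_closure I ?B" by simp
    qed (use B in auto)
    moreover have "X' = ?B \<union> (X' - ?B)" using B by auto
    ultimately show "X' \<in> (\<lambda>Y. ?B \<union> Y) ` independent_sets (remove_vertices I (nbhd_closure I ?B))"
      by blast
  next
    let ?B = "conflicts I X"
    fix X' assume "X' \<in> (\<lambda>Y. ?B \<union> Y) ` independent_sets (remove_vertices I (nbhd_closure I ?B))"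
    then obtain Y where Y: "Y \<in> independent_sets (remove_vertices I (nbhd_closure I ?B))"
      "X' = ?B \<union> Y" by auto
    have "conflicts I X' = ?B" using conflicts_union_independent[OF I refl Y(1)] Y(2) by simp
    moreover have "X' \<in> conflict_free_off I W"
      unfolding conflict_free_off_def
    proof (intro CollectI conjI ballI)
      show "X' \<subseteq> verts I"
        using Y X unfolding independent_remove_vertices_iff[OF I]
        by (auto simp: conflict_free_off_def conflicts_def)
      fix v u assume vu: "v \<in> X' - W" "u \<in> X' - W"
      show "u \<notin> neighbours I v"
      proof
        assume "u \<in> neighbours I v"
        \<comment> \<open>A violated edge of \<open>X'\<close> has both endpoints in the conflict
          set of \<open>X\<close>, so it was violated in \<open>X\<close> already and must meet
          \<open>W\<close>.\<close>
        then have "v \<in> conflicts I X'" "u \<in> conflicts I X'"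
          using vu neighbours_sym[of u I v] by (auto simp: conflicts_def)
        then have "v \<in> X" "u \<in> X" unfolding \<open>conflicts I X' = ?B\<close> by (auto simp: conflicts_def)
        with X vu \<open>u \<in> neighbours I v\<close> show False by (auto simp: conflict_free_off_def)
      qed
    qed
    ultimately show "X' \<in> {X' \<in> conflict_free_off I W. conflicts I X' = ?B}" by simp
  qed
  show "conflicts I X \<inter> (verts I - nbhd_closure I (conflicts I X)) = {}" for X
    by (auto simp: nbhd_closure_def closed_nbhd_def)
qed simp

section \<open>Contraction of the resampled region\<close>

text \<open>Deleting \<open>v\<close> maps the members containing \<open>v\<close> injectively to
  members without it and takes the factor \<open>lam v\<close> off their weight. The former
  therefore carry at most the fraction \<open>lam v / (1 + lam v)\<close> of the total.\<close>

lemma sum_prod_containing_le: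
  fixes lam :: "'v \<Rightarrow> real"
  assumes fin: "finite Q" "\<And>X. X \<in> Q \<Longrightarrow> finite X"
    and closed: "\<And>X. X \<in> Q \<Longrightarrow> X - {v} \<in> Q"
    and nonneg: "\<And>X w. X \<in> Q \<Longrightarrow> w \<in> X \<Longrightarrow> lam w \<ge> 0" and v: "lam v \<ge> 0"
  shows "(1 + lam v) * (\<Sum>X | X \<in> Q \<and> v \<in> X. \<Prod>w\<in>X. lam w)
       \<le> lam v * (\<Sum>X\<in>Q. \<Prod>w\<in>X. lam w)"
proof -
  define g where "g X = (\<Prod>w\<in>X. lam w)" for X
  define a where "a = (\<Sum>X | X \<in> Q \<and> v \<in> X. g X)"
  define s where "s = (\<Sum>X | X \<in> Q \<and> v \<in> X. g (X - {v}))"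
  have g_nonneg: "g X \<ge> 0" if "X \<in> Q" for X
    unfolding g_def using nonneg[OF that] by (intro prod_nonneg) auto
  have "a = (\<Sum>X | X \<in> Q \<and> v \<in> X. lam v * g (X - {v}))"
    unfolding a_def g_def using fin by (intro sum.cong refl prod.remove) auto
  then have a: "a = lam v * s" by (simp add: s_def sum_distrib_left)
  have "s = sum g ((\<lambda>X. X - {v}) ` {X. X \<in> Q \<and> v \<in> X})"
    unfolding s_def by (subst sum.reindex) (auto intro!: inj_onI)
  also have "\<dots> \<le> sum g {X. X \<in> Q \<and> v \<notin> X}"
    using fin closed g_nonneg by (intro sum_mono2) auto
  finally have "a + s \<le> sum g {X. X \<in> Q \<and> v \<in> X} + sum g {X. X \<in> Q \<and> v \<notin> X}"
    by (simp add: a_def)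
  also have "\<dots> = sum g ({X. X \<in> Q \<and> v \<in> X} \<union> {X. X \<in> Q \<and> v \<notin> X})"
    using fin by (intro sum.union_disjoint[symmetric]) auto
  also have "{X. X \<in> Q \<and> v \<in> X} \<union> {X. X \<in> Q \<and> v \<notin> X} = Q" by auto
  finally have "lam v * (a + s) \<le> lam v * sum g Q" using v by (intro mult_left_mono)
  then have "(1 + lam v) * a \<le> lam v * sum g Q" using a by (simp add: algebra_simps)
  then show ?thesis by (simp add: a_def g_def)
qed

text \<open>The single-vertex bound is applied to \<open>v\<close> among the configurations
  containing \<open>u\<close>, then to \<open>u\<close>. The two events may be correlated; what
  matters is closure under deletion, and deleting \<open>v\<close> keeps \<open>u\<close> since they
  differ.\<close>

lemma prob_resampled_pair_le:
  assumes I: "hardcore_model I" and W: "W \<subseteq> verts I"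
    and uv: "u \<in> verts I" "v \<in> verts I" "u \<noteq> v"
  shows "measure (measure_pmf (resampled I W)) {X. u \<in> X \<and> v \<in> X}
       \<le> occupation_prob I u * occupation_prob I v"
proof -
  define Q where "Q = conflict_free_off I W"
  define lam where "lam = fugacity I"
  define c where
    "c = 1 / (partition_function (remove_vertices I W) * (\<Prod>v\<in>W. 1 + fugacity I v))"
  define g where "g X = (\<Prod>w\<in>X. lam w)" for X
  have finV: "finite (verts I)" using I by (simp add: hardcore_model_def)
  have pos: "lam w > 0" if "w \<in> verts I" for w
    using I that by (simp add: hardcore_model_def lam_def)
  have finQ: "finite Q"
    by (rule finite_subset[of _ "Pow (verts I)"]) (use finV in \<open>auto simp: Q_def conflict_free_off_def\<close>)
  have QV: "X \<subseteq> verts I" if "X \<in> Q" for X using that by (auto simp: Q_def conflict_free_off_def)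
  have nonneg: "0 \<le> lam w" if "X \<in> Q" "w \<in> X" for X w
    using pos[of w] QV[OF that(1)] that(2) by auto
  have finX: "finite X" if "X \<in> Q" for X using finite_subset[OF QV[OF that] finV] .
  have closed: "X - {w} \<in> Q" if "X \<in> Q" for X w
    using that by (auto simp: Q_def conflict_free_off_def)
  have c: "c \<ge> 0"
    unfolding c_def
    using partition_function_pos[OF hardcore_model_remove_vertices[OF I], of W] pos W
    by (auto simp: lam_def intro!: divide_nonneg_nonneg mult_nonneg_nonneg prod_nonneg add_nonneg_nonneg
        dest: less_imp_le)
  have pmf: "pmf (resampled I W) X = c * g X" if "X \<in> Q" for X
    using that by (simp add: pmf_resampled[OF I W] c_def g_def lam_def Q_def)
  have sub: "set_pmf (resampled I W) \<subseteq> Q"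
    unfolding Q_def by (rule set_pmf_resampled_subset[OF I W])
  have meas: "measure (measure_pmf (resampled I W)) {X. P X} = c * (\<Sum>X | X \<in> Q \<and> P X. g X)" for P
  proof -
    have "measure (measure_pmf (resampled I W)) {X. P X}
        = measure (measure_pmf (resampled I W)) {X. X \<in> Q \<and> P X}"
      by (rule measure_pmf.finite_measure_eq_AE) (use sub in \<open>auto simp: AE_measure_pmf_iff\<close>)
    also have "\<dots> = (\<Sum>X | X \<in> Q \<and> P X. pmf (resampled I W) X)"
      using finQ by (simp add: measure_measure_pmf_finite)
    finally show ?thesis by (simp add: pmf sum_distrib_left)
  qed
  have one: "c * (\<Sum>X\<in>Q. g X) = 1"
    using meas[of "\<lambda>_. True"] measure_pmf.prob_space[of "resampled I W"] by simp
  have "(1 + lam v) * (\<Sum>X | X \<in> {X. X \<in> Q \<and> u \<in> X} \<and> v \<in> X. g X)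
      \<le> lam v * (\<Sum>X | X \<in> Q \<and> u \<in> X. g X)"
    unfolding g_def
    using finQ finX closed nonneg uv pos[OF uv(1)] pos[OF uv(2)]
    by (intro sum_prod_containing_le) auto
  also have "{X. X \<in> {X. X \<in> Q \<and> u \<in> X} \<and> v \<in> X} = {X. X \<in> Q \<and> u \<in> X \<and> v \<in> X}" by auto
  finally have 1: "(\<Sum>X | X \<in> Q \<and> u \<in> X \<and> v \<in> X. g X)
      \<le> occupation_prob I v * (\<Sum>X | X \<in> Q \<and> u \<in> X. g X)"
    using pos[OF uv(2)] by (simp add: occupation_prob_def lam_def[symmetric] field_simps)
  have "(1 + lam u) * (\<Sum>X | X \<in> Q \<and> u \<in> X. g X) \<le> lam u * (\<Sum>X\<in>Q. g X)"
    unfolding g_def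
    using finQ finX closed nonneg uv pos[OF uv(1)] pos[OF uv(2)]
    by (intro sum_prod_containing_le) auto
  then have 2: "(\<Sum>X | X \<in> Q \<and> u \<in> X. g X) \<le> occupation_prob I u * (\<Sum>X\<in>Q. g X)"
    using pos[OF uv(1)] by (simp add: occupation_prob_def lam_def[symmetric] field_simps)
  have "measure (measure_pmf (resampled I W)) {X. u \<in> X \<and> v \<in> X}
      = c * (\<Sum>X | X \<in> Q \<and> u \<in> X \<and> v \<in> X. g X)"
    by (rule meas)
  also have "\<dots> \<le> c * (occupation_prob I v * (occupation_prob I u * (\<Sum>X\<in>Q. g X)))"
    using 1 2 c occupation_prob_bounds[OF I uv(2)]
    by (intro mult_left_mono order_trans[OF 1] mult_left_mono[OF 2]) auto
  also have "\<dots> = occupation_prob I u * occupation_prob I v * (c * (\<Sum>X\<in>Q. g X))" by simp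
  finally show ?thesis by (simp add: one)
qed

section \<open>Counting edges that meet a region and vertices near conflicts\<close>

definition incident_edges :: "'v hardcore \<Rightarrow> 'v set \<Rightarrow> 'v set set" where
  "incident_edges I W = {e \<in> edges I. e \<inter> W \<noteq> {}}"

text \<open>Guaranteed for every region after the first; it saves the \<open>1 / 2\<close> per
  vertex that makes the expected size shrink.\<close>

definition crowded :: "'v hardcore \<Rightarrow> 'v set \<Rightarrow> bool" where
  "crowded I W \<longleftrightarrow> (\<forall>v\<in>W. neighbours I v \<inter> W \<noteq> {})"

lemma finite_edges:
  assumes "hardcore_model I" shows "finite (edges I)"
  by (rule finite_subset[of _ "Pow (verts I)"]) (use assms in \<open>auto simp: hardcore_model_def\<close>)

text \<open>
  Every incident edge distributes the weight \<open>1\<close> evenly over its endpoints in \<open>W\<close>; a vertex with a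
  neighbour in \<open>W\<close> receives only \<open>1/2\<close> from one of its edges.
\<close>

lemma card_incident_edges_le:
  assumes I: "hardcore_model I" and W: "W \<subseteq> verts I"
    and deg: "\<And>v. v \<in> verts I \<Longrightarrow> card (neighbours I v) \<le> \<Delta>"
  shows "real (card (incident_edges I W)) \<le> (real \<Delta> - (if crowded I W then 1 / 2 else 0)) * real (card W)"
proof -
  define wt where "wt e = (1 :: real) / real (card (e \<inter> W))" for e
  define E where "E v = {e \<in> edges I. v \<in> e}" for v
  have finE: "finite (edges I)" by (rule finite_edges[OF I])
  have finW: "finite W" using W I by (auto simp: hardcore_model_def intro: finite_subset)
  have cardE: "card (E v) \<le> \<Delta>" if "v \<in> verts I" for v
  proof -
    have "E v \<subseteq> (\<lambda>u. {u, v}) ` neighbours I v"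
    proof
      fix e assume "e \<in> E v"
      then have "e \<in> edges I" "v \<in> e" by (auto simp: E_def)
      then show "e \<in> (\<lambda>u. {u, v}) ` neighbours I v"
        by (auto elim!: edge_obtain[OF I] simp: neighbours_sym[of _ I v] insert_commute)
    qed
    then have "card (E v) \<le> card (neighbours I v)"
      by (rule surj_card_le[OF finite_neighbours[OF I]])
    with deg[OF that] show ?thesis by simp
  qed
  \<comment> \<open>An edge missing \<open>W\<close> has weight \<open>1 / 0 = 0\<close>.\<close>
  have wt_le: "wt e \<le> 1" for e
    unfolding wt_def by (cases "card (e \<inter> W)") (auto simp: field_simps)
  have vertex: "(\<Sum>e\<in>E v. wt e) \<le> real \<Delta> - (if crowded I W then 1 / 2 else 0)" if v: "v \<in> W" for v
  proof (cases "crowded I W")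
    case False
    have "(\<Sum>e\<in>E v. wt e) \<le> (\<Sum>e\<in>E v. 1)" by (intro sum_mono wt_le)
    also have "\<dots> \<le> real \<Delta>" using cardE v W by auto
    finally show ?thesis using False by simp
  next
    case True
    then obtain u where u: "u \<in> neighbours I v" "u \<in> W" using v by (auto simp: crowded_def)
    define e where "e = {u, v}"
    have e: "e \<in> E v" using u by (simp add: e_def E_def neighbours_def)
    have "e \<inter> W = e" "card e = 2" using u v neighboursD(3)[OF I u(1)] by (auto simp: e_def)
    then have "wt e = 1 / 2" by (simp add: wt_def)
    have "(\<Sum>e\<in>E v. wt e) = wt e + (\<Sum>e\<in>E v - {e}. wt e)"
      using e finE by (intro sum.remove) (auto simp: E_def)
    also have "\<dots> \<le> 1 / 2 + (\<Sum>e\<in>E v - {e}. 1)"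
      unfolding \<open>wt e = 1 / 2\<close> by (intro add_left_mono sum_mono wt_le)
    also have "\<dots> = real (card (E v)) - 1 / 2"
    proof -
      have "finite (E v)" using finE by (auto simp: E_def)
      then have "card (E v) = Suc (card (E v - {e}))" using e by (rule card.remove)
      then show ?thesis by simp
    qed
    also have "\<dots> \<le> real \<Delta> - 1 / 2" using cardE[of v] v W by auto
    finally show ?thesis using True by simp
  qed
  have "real (card (incident_edges I W)) = (\<Sum>e\<in>incident_edges I W. real (card (e \<inter> W)) * wt e)"
  proof -
    have "real (card (e \<inter> W)) * wt e = 1" if "e \<in> incident_edges I W" for e
      using that finW by (auto simp: incident_edges_def wt_def)
    then show ?thesis by simp
  qed
  also have "\<dots> = (\<Sum>e\<in>incident_edges I W. \<Sum>v | v \<in> W \<and> v \<in> e. wt e)"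
    by (intro sum.cong) (auto simp: Int_def conj_commute)
  also have "\<dots> = (\<Sum>v\<in>W. \<Sum>e | e \<in> incident_edges I W \<and> v \<in> e. wt e)"
    by (rule sum.swap_restrict) (use finE finW in \<open>auto simp: incident_edges_def\<close>)
  also have "\<dots> = (\<Sum>v\<in>W. \<Sum>e\<in>E v. wt e)"
    by (intro sum.cong) (auto simp: incident_edges_def E_def)
  also have "\<dots> \<le> (\<Sum>v\<in>W. real \<Delta> - (if crowded I W then 1 / 2 else 0))"
    by (intro sum_mono vertex)
  finally show ?thesis by (simp add: mult.commute)
qed

lemma card_nbhd_closure_le:
  assumes I: "hardcore_model I" and B: "B \<subseteq> verts I"
    and deg: "\<And>v. v \<in> verts I \<Longrightarrow> card (neighbours I v) \<le> \<Delta>"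
  shows "card (nbhd_closure I B) \<le> (\<Delta> + 1) * card B"
proof -
  have "finite B" using B I by (auto simp: hardcore_model_def intro: finite_subset)
  then have "card (nbhd_closure I B) \<le> (\<Sum>v\<in>B. card (closed_nbhd I v))"
    unfolding nbhd_closure_def by (rule card_UN_le)
  also have "\<dots> \<le> (\<Sum>v\<in>B. \<Delta> + 1)"
  proof (rule sum_mono)
    fix v assume "v \<in> B"
    then have "card (neighbours I v) \<le> \<Delta>" using B deg by auto
    then show "card (closed_nbhd I v) \<le> \<Delta> + 1"
      unfolding closed_nbhd_def using card_insert_le_m1[of "Suc \<Delta>" "neighbours I v" v] by simp
  qed
  finally show ?thesis by (simp add: mult.commute)
qed

text \<open>Each end of a violated edge is a neighbour of the other, so the open neighbourhoods of
  the two ends already cover the closed ones; this is why \<open>2 * \<Delta>\<close> vertices per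
  edge suffice.\<close>

lemma card_nbhd_closure_conflicts_le:
  assumes I: "hardcore_model I" and X: "X \<subseteq> verts I"
    and deg: "\<And>v. v \<in> verts I \<Longrightarrow> card (neighbours I v) \<le> \<Delta>"
  shows "card (nbhd_closure I (conflicts I X)) \<le> (\<Sum>e | e \<in> edges I \<and> e \<subseteq> X. 2 * \<Delta>)"
proof -
  let ?E = "{e. e \<in> edges I \<and> e \<subseteq> X}"
  have fin: "finite ?E" using finite_edges[OF I] by auto
  have "nbhd_closure I (conflicts I X) \<subseteq> (\<Union>e\<in>?E. \<Union>v\<in>e. neighbours I v)"
  proof
    fix w assume "w \<in> nbhd_closure I (conflicts I X)"
    then obtain v u where vu: "v \<in> X" "u \<in> X" "u \<in> neighbours I v" "w = v \<or> w \<in> neighbours I v"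
      by (auto simp: nbhd_closure_def closed_nbhd_def conflicts_def)
    then have "{u, v} \<in> ?E" by (auto simp: neighbours_def)
    moreover have "w \<in> (\<Union>v\<in>{u, v}. neighbours I v)" using vu neighbours_sym[of u I v] by auto
    ultimately show "w \<in> (\<Union>e\<in>?E. \<Union>v\<in>e. neighbours I v)" by blast
  qed
  then have "card (nbhd_closure I (conflicts I X)) \<le> card (\<Union>e\<in>?E. \<Union>v\<in>e. neighbours I v)"
    using fin I by (intro card_mono) (auto elim!: edge_obtain[OF I] simp: finite_neighbours)
  also have "\<dots> \<le> (\<Sum>e\<in>?E. card (\<Union>v\<in>e. neighbours I v))"
    by (rule card_UN_le[OF fin])
  also have "\<dots> \<le> (\<Sum>e\<in>?E. 2 * \<Delta>)"
  proof (rule sum_mono)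
    fix e assume "e \<in> ?E"
    then obtain u v where uv: "e = {u, v}" "u \<in> verts I" "v \<in> verts I"
      using edge_obtain[OF I] by blast
    have "card (neighbours I u \<union> neighbours I v) \<le> card (neighbours I u) + card (neighbours I v)"
      by (rule card_Un_le)
    also have "\<dots> \<le> 2 * \<Delta>" using deg[OF uv(2)] deg[OF uv(3)] by simp
    finally show "card (\<Union>v\<in>e. neighbours I v) \<le> 2 * \<Delta>" by (simp add: uv(1))
  qed
  finally show ?thesis .
qed

text \<open>A vertex in conflict has a partner in conflict, and every other vertex of the closure is
  adjacent to one in conflict.\<close>

lemma crowded_nbhd_closure_conflicts: "crowded I (nbhd_closure I (conflicts I X))"
  unfolding crowded_def
proof
  fix v assume "v \<in> nbhd_closure I (conflicts I X)"
  then obtain u where u: "u \<in> conflicts I X" "v = u \<or> v \<in> neighbours I u"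
    by (auto simp: nbhd_closure_def closed_nbhd_def)
  have sub: "conflicts I X \<subseteq> nbhd_closure I (conflicts I X)"
    by (auto simp: nbhd_closure_def closed_nbhd_def)
  show "neighbours I v \<inter> nbhd_closure I (conflicts I X) \<noteq> {}"
  proof (cases "v = u")
    case True
    with u(1) obtain w where w: "w \<in> X" "w \<in> neighbours I v" "u \<in> X" by (auto simp: conflicts_def)
    then have "w \<in> conflicts I X" using True neighbours_sym[of w I v] by (auto simp: conflicts_def)
    with w sub show ?thesis by blast
  next
    case False
    with u(2) have "u \<in> neighbours I v" using neighbours_sym[of v I u] by simp
    with u(1) sub show ?thesis by blast
  qed
qed

section \<open>Expected decay of the region under the fugacity bound\<close>

locale low_fugacity =
  fixes I :: "'v hardcore" and \<Delta> :: nat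
  assumes model: "hardcore_model I"
    and degree: "max_degree I \<le> \<Delta>"
    and low: "\<And>v. v \<in> verts I \<Longrightarrow> fugacity I v \<le> 1 / (sqrt 2 * real \<Delta> - 1)"
begin

lemma finite_verts: "finite (verts I)"
  using model by (simp add: hardcore_model_def)

lemma card_neighbours_le: "v \<in> verts I \<Longrightarrow> card (neighbours I v) \<le> \<Delta>"
  using degree finite_verts by (auto simp: max_degree_def)

text \<open>For \<open>\<Delta> = 0\<close> the bound on the fugacities is negative, which leaves only the empty graph.\<close>

lemma degree_pos:
  assumes "v \<in> verts I" shows "\<Delta> > 0"
proof (rule ccontr)
  assume "\<not> \<Delta> > 0"
  then show False using low[OF assms] model assms by (force simp: hardcore_model_def)
qed

text \<open>The increasing map \<open>t / (1 + t)\<close> takes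
  \<open>1 / (sqrt 2 * real \<Delta> - 1)\<close> to
  \<open>1 / (sqrt 2 * real \<Delta>)\<close>.\<close>

lemma occupation_prob_le:
  assumes "v \<in> verts I"
  shows "occupation_prob I v \<le> 1 / (sqrt 2 * real \<Delta>)"
proof -
  \<comment> \<open>The denominator of the fugacity bound must be positive before the bound is
    multiplied out.\<close>
  have "1 < sqrt 2 * 1" by simp
  also have "\<dots> \<le> sqrt 2 * real \<Delta>" using degree_pos[OF assms] by (intro mult_left_mono) auto
  finally have gt: "sqrt 2 * real \<Delta> - 1 > 0" by simp
  have pos: "fugacity I v > 0" using model assms by (simp add: hardcore_model_def)
  have "fugacity I v * (sqrt 2 * real \<Delta> - 1) \<le> 1"
    using low[OF assms] gt by (simp add: pos_le_divide_eq)
  then have "fugacity I v * (sqrt 2 * real \<Delta>) \<le> 1 + fugacity I v" by (simp add: algebra_simps)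
  then show ?thesis
    using pos gt degree_pos[OF assms] by (simp add: occupation_prob_def divide_simps)
qed

text \<open>Slightly larger than \<open>1 - 1 / (2 \<Delta>)\<close>, so that \<open>0 < decay < 1\<close> also holds for \<open>\<Delta> = 0\<close>.\<close>

definition decay :: real where
  "decay = 1 - 1 / (2 * real \<Delta> + 2)"

text \<open>
  Only the first region can fail to be crowded; the division makes up for the missing contraction
  in the first step.
\<close>

definition potential :: "'v set \<Rightarrow> real" where
  "potential W = (if crowded I W then real (card W) else real (card W) / decay)"

lemma decay_bounds: "1 / 2 \<le> decay" "decay < 1"
  by (auto simp: decay_def field_simps)

lemma potential_bounds:
  "real (card W) \<le> potential W" "potential W \<le> 2 * real (card W)"
  using decay_bounds mult_right_mono[of decay 1 "real (card W)"]
    mult_right_mono[of "1 / 2" decay "real (card W)"]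
  by (auto simp: potential_def field_simps)

lemma potential_nonneg [simp]: "0 \<le> potential W"
  using potential_bounds(1)[of W] by linarith

lemma potential_empty [simp]: "potential {} = 0"
  by (simp add: potential_def)

text \<open>Lets the potential dominate the indicator of a nonempty region and keeps its logarithm
  nonnegative.\<close>

lemma potential_ge_1:
  assumes "W \<subseteq> verts I" "W \<noteq> {}"
  shows "1 \<le> potential W"
proof -
  have "card W \<noteq> 0" using assms finite_subset[OF _ finite_verts] by auto
  then show ?thesis using potential_bounds(1)[of W] by linarith
qed

text \<open>Union bound over the edges meeting \<open>W\<close>: each brings at most
  \<open>2 * \<Delta>\<close> vertices when violated, hence at most \<open>1 / \<Delta>\<close> in
  expectation, and crowding of \<open>W\<close> decides how many edges there are.\<close>

lemma potential_contraction:
  assumes W: "W \<subseteq> verts I"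
  shows "(\<integral>\<^sup>+ B. ennreal (potential (nbhd_closure I B)) \<partial>next_conflicts I W)
       \<le> ennreal (decay * potential W)"
proof -
  let ?J = "resampled I W"
  have fin: "finite (incident_edges I W)"
    using finite_edges[OF model] by (auto simp: incident_edges_def)
  have edge: "ennreal (2 * real \<Delta>) * emeasure (measure_pmf ?J) {X. e \<subseteq> X} \<le> ennreal (1 / real \<Delta>)"
    if e: "e \<in> incident_edges I W" for e
  proof -
    have "e \<in> edges I" using e by (simp add: incident_edges_def)
    from edge_obtain[OF model this] obtain u v
      where uv: "e = {u, v}" "u \<noteq> v" "u \<in> verts I" "v \<in> verts I" by metis
    have pos: "real \<Delta> > 0" using degree_pos[OF uv(3)] by simp
    have "measure (measure_pmf ?J) {X. e \<subseteq> X} \<le> occupation_prob I u * occupation_prob I v"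
      using prob_resampled_pair_le[OF model W uv(3,4,2)] by (simp add: uv(1))
    also have "\<dots> \<le> (1 / (sqrt 2 * real \<Delta>)) * (1 / (sqrt 2 * real \<Delta>))"
      using occupation_prob_bounds[OF model] uv
      by (intro mult_mono occupation_prob_le) (auto intro: less_imp_le)
    also have "\<dots> = 1 / (2 * real \<Delta> * real \<Delta>)" by (simp add: field_simps)
    finally have "2 * real \<Delta> * measure (measure_pmf ?J) {X. e \<subseteq> X} \<le> 1 / real \<Delta>"
      using pos by (simp add: field_simps)
    then show ?thesis
      by (simp add: measure_pmf.emeasure_eq_measure ennreal_mult''[symmetric])
  qed
  have "(\<integral>\<^sup>+ B. ennreal (potential (nbhd_closure I B)) \<partial>next_conflicts I W)
      = (\<integral>\<^sup>+ X. ennreal (real (card (nbhd_closure I (conflicts I X)))) \<partial>?J)"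
    \<comment> \<open>The next region is crowded, so its potential is just its size.\<close>
    by (simp add: next_conflicts_def potential_def crowded_nbhd_closure_conflicts)
  also have "\<dots> \<le> (\<integral>\<^sup>+ X. (\<Sum>e\<in>incident_edges I W. ennreal (2 * real \<Delta>) * indicator {X. e \<subseteq> X} X) \<partial>?J)"
  proof (rule nn_integral_mono_AE, unfold AE_measure_pmf_iff, intro ballI)
    fix X assume "X \<in> set_pmf ?J"
    then have X: "X \<in> conflict_free_off I W" using set_pmf_resampled_subset[OF model W] by auto
    then have XV: "X \<subseteq> verts I" by (simp add: conflict_free_off_def)
    have "{e. e \<in> edges I \<and> e \<subseteq> X} \<subseteq> {e \<in> incident_edges I W. e \<subseteq> X}"
    proof
      fix e assume e: "e \<in> {e. e \<in> edges I \<and> e \<subseteq> X}"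
      then have "e \<in> edges I" by simp
      from edge_obtain[OF model this] obtain u v where uv: "e = {u, v}" "u \<in> neighbours I v"
        by metis
      \<comment> \<open>There are no conflicts off \<open>W\<close>, so a violated edge meets
        \<open>W\<close>.\<close>
      have "e \<inter> W \<noteq> {}"
        using e X uv unfolding conflict_free_off_def by blast
      then show "e \<in> {e \<in> incident_edges I W. e \<subseteq> X}" using e by (simp add: incident_edges_def)
    qed
    then have "(\<Sum>e | e \<in> edges I \<and> e \<subseteq> X. 2 * \<Delta>) \<le> (\<Sum>e | e \<in> incident_edges I W \<and> e \<subseteq> X. 2 * \<Delta>)"
      using fin by (intro sum_mono2) auto
    with card_nbhd_closure_conflicts_le[OF model XV card_neighbours_le]
    have "card (nbhd_closure I (conflicts I X)) \<le> (\<Sum>e | e \<in> incident_edges I W \<and> e \<subseteq> X. 2 * \<Delta>)"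
      by linarith
    then have "real (card (nbhd_closure I (conflicts I X)))
        \<le> real (\<Sum>e | e \<in> incident_edges I W \<and> e \<subseteq> X. 2 * \<Delta>)"
      by (rule of_nat_mono)
    also have "\<dots> = (\<Sum>e\<in>incident_edges I W. 2 * real \<Delta> * indicator {X. e \<subseteq> X} X)"
      using fin by (simp add: sum.inter_filter[symmetric] indicator_def if_distrib Int_def
          cong: if_cong)
    finally have "ennreal (real (card (nbhd_closure I (conflicts I X))))
        \<le> ennreal (\<Sum>e\<in>incident_edges I W. 2 * real \<Delta> * indicator {X. e \<subseteq> X} X)"
      by (rule ennreal_leI)
    also have "\<dots> = (\<Sum>e\<in>incident_edges I W. ennreal (2 * real \<Delta> * indicator {X. e \<subseteq> X} X))"
      by (rule sum_ennreal[symmetric]) simp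
    also have "\<dots> = (\<Sum>e\<in>incident_edges I W. ennreal (2 * real \<Delta>) * indicator {X. e \<subseteq> X} X)"
      by (intro sum.cong) (auto simp: indicator_def)
    finally show "ennreal (real (card (nbhd_closure I (conflicts I X))))
        \<le> (\<Sum>e\<in>incident_edges I W. ennreal (2 * real \<Delta>) * indicator {X. e \<subseteq> X} X)" .
  qed
  also have "\<dots> = (\<Sum>e\<in>incident_edges I W. ennreal (2 * real \<Delta>) * emeasure (measure_pmf ?J) {X. e \<subseteq> X})"
    by (simp add: nn_integral_sum nn_integral_cmult)
  also have "\<dots> \<le> (\<Sum>e\<in>incident_edges I W. ennreal (1 / real \<Delta>))"
    by (intro sum_mono edge)
  also have "\<dots> = ennreal (real (card (incident_edges I W)) / real \<Delta>)"
    by (simp add: ennreal_of_nat_eq_real_of_nat ennreal_mult'[symmetric])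
  also have "\<dots> \<le> ennreal (decay * potential W)"
  proof (rule ennreal_leI, cases "\<Delta> = 0")
    case False
    then have "real \<Delta> \<ge> 1" by simp
    have "real (card (incident_edges I W)) / real \<Delta>
        \<le> (real \<Delta> - (if crowded I W then 1 / 2 else 0)) * real (card W) / real \<Delta>"
      using card_incident_edges_le[OF model W card_neighbours_le] by (intro divide_right_mono) auto
    also have "\<dots> \<le> decay * potential W"
    proof (cases "crowded I W")
      case True
      have "(real \<Delta> - 1 / 2) / real \<Delta> \<le> decay"
        using \<open>real \<Delta> \<ge> 1\<close> by (simp add: decay_def field_simps)
      then have "(real \<Delta> - 1 / 2) / real \<Delta> * real (card W) \<le> decay * real (card W)"
        by (rule mult_right_mono) simp
      then show ?thesis using True by (simp add: potential_def)
    \<comment> \<open>Without crowding, \<open>decay\<close> cancels the division in the potential,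
      and the plain bound \<open>\<Delta> * card W\<close> on the number of edges suffices.\<close>
    qed (use decay_bounds \<open>\<Delta> \<noteq> 0\<close> in \<open>simp add: potential_def\<close>)
    finally show "real (card (incident_edges I W)) / real \<Delta> \<le> decay * potential W" .
  next
    case True
    \<comment> \<open>For \<open>\<Delta> = 0\<close> the quotient on the left is a division by
      zero, hence 0.\<close>
    have "0 \<le> decay * potential W" using decay_bounds by (intro mult_nonneg_nonneg) auto
    then show "real (card (incident_edges I W)) / real \<Delta> \<le> decay * potential W"
      by (simp add: True)
  qed
  finally show ?thesis .
qed

end

section \<open>The algorithm\<close>

text \<open>
  Rounds alternate between two phases.  In an expansion round the active vertices carry memory
  \<open>1\<close>, draw a dummy bit, and announce themselves to their neighbours; this is needed because the
  region to be resampled is determined by vertices at distance two.  In a resampling round the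
  active vertices carry memory \<open>2\<close> and draw a new spin.  Vertices with memory \<open>0\<close> are idle and
  do not need to know the current phase.
\<close>

definition resampler :: "'v algorithm" where
  "resampler = \<lparr>
     start = (\<lambda>old w. case old of
         None \<Rightarrow> \<lparr>spin = False, active = True, memory = 1\<rparr>
       | Some (w0, x) \<Rightarrow>
           (let changed = (adjacent w0 \<noteq> adjacent w \<or>
                           local_fugacity w0 (centre w) \<noteq> local_fugacity w (centre w))
            in \<lparr>spin = x (centre w), active = changed, memory = if changed then 1 else 0\<rparr>)),
     draw = (\<lambda>w s. if memory (s (centre w)) = 2
         then bernoulli_pmf (local_fugacity w (centre w) / (1 + local_fugacity w (centre w)))
         else return_pmf False),
     step = (\<lambda>w s b.
         if \<exists>u\<in>insert (centre w) (adjacent w). memory (s u) = 2 then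
           (let x = (\<lambda>u. if active (s u) then b u else spin (s u));
                conflict = (x (centre w) \<and> (\<exists>u\<in>adjacent w. x u))
            in \<lparr>spin = x (centre w), active = conflict, memory = if conflict then 1 else 0\<rparr>)
         else
           (let exposed = (memory (s (centre w)) = 1 \<or>
                           (\<exists>u\<in>adjacent w. memory (s u) = 1 \<and> spin (s u)))
            in \<lparr>spin = spin (s (centre w)) \<and> \<not> exposed, active = exposed,
                memory = if exposed then 2 else 0\<rparr>))\<rparr>"

section \<open>Configurations of the two phases\<close>

definition expansion_config :: "'v hardcore \<Rightarrow> 'v set \<Rightarrow> 'v set \<Rightarrow> 'v \<Rightarrow> node" where
  "expansion_config I R X =
     (\<lambda>v\<in>verts I. \<lparr>spin = v \<in> X, active = v \<in> R, memory = if v \<in> R then 1 else 0\<rparr>)"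

text \<open>Spins inside \<open>W\<close> are blanked, so the configuration depends only on the part
  of \<open>Y\<close> off \<open>W\<close>.\<close>

definition resampling_config :: "'v hardcore \<Rightarrow> 'v set \<Rightarrow> 'v set \<Rightarrow> 'v \<Rightarrow> node" where
  "resampling_config I W Y =
     (\<lambda>v\<in>verts I. \<lparr>spin = v \<in> Y \<and> v \<notin> W, active = v \<in> W, memory = if v \<in> W then 2 else 0\<rparr>)"

text \<open>A vacant member of \<open>R\<close> puts no constraint on its neighbours, so only
  occupied members spread. Conflict sets are fully occupied and yield their whole closure; the
  vertices changed by an update need not be.\<close>

definition exposed_set :: "'v hardcore \<Rightarrow> 'v set \<Rightarrow> 'v set \<Rightarrow> 'v set" where
  "exposed_set I R X = R \<union> {v. \<exists>u\<in>neighbours I v. u \<in> R \<and> u \<in> X}"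

lemma exposed_set_empty [simp]: "exposed_set I {} X = {}"
  by (simp add: exposed_set_def)

lemma nbhd_closure_iff: "v \<in> nbhd_closure I B \<longleftrightarrow> v \<in> B \<or> (\<exists>u\<in>neighbours I v. u \<in> B)"
  unfolding nbhd_closure_def closed_nbhd_def by (auto dest: neighbours_sym[THEN iffD1])

lemma exposed_set_subset_nbhd_closure: "exposed_set I R X \<subseteq> nbhd_closure I R"
  by (auto simp: exposed_set_def nbhd_closure_iff)

lemma exposed_set_union: "exposed_set I B (B \<union> Y) = nbhd_closure I B"
  by (auto simp: exposed_set_def nbhd_closure_iff)

lemma nbhd_closure_subset_verts:
  assumes "hardcore_model I" "B \<subseteq> verts I"
  shows "nbhd_closure I B \<subseteq> verts I"
  using assms neighboursD[OF assms(1)] by (auto simp: nbhd_closure_def closed_nbhd_def)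

section \<open>Transitions of a single round\<close>

lemma active_set_expansion: "R \<subseteq> verts I \<Longrightarrow> active_set I (expansion_config I R X) = R"
  by (auto simp: active_set_def expansion_config_def)

lemma active_set_resampling: "W \<subseteq> verts I \<Longrightarrow> active_set I (resampling_config I W Y) = W"
  by (auto simp: active_set_def resampling_config_def)

text \<open>The dummy draws are deterministic, so an expansion round adds no randomness although its
  draws are charged as samplings.\<close>

lemma samplings_expansion:
  assumes "R \<subseteq> verts I" "finite R"
  shows "samplings resampler I (expansion_config I R X) = return_pmf (\<lambda>_. False)"
proof -
  have "samplings resampler I (expansion_config I R X) = Pi_pmf R False (\<lambda>_. return_pmf False)"
    unfolding samplings_def active_set_expansion[OF assms(1)]
    using assms
    by (intro Pi_pmf_cong) (auto simp: resampler_def view_def expansion_config_def closed_nbhd_def)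
  then show ?thesis using assms(2) by simp
qed

lemma samplings_resampling:
  assumes "W \<subseteq> verts I"
  shows "samplings resampler I (resampling_config I W Y)
       = Pi_pmf W False (\<lambda>v. bernoulli_pmf (occupation_prob I v))"
  unfolding samplings_def active_set_resampling[OF assms]
  using assms
  by (intro Pi_pmf_cong)
     (auto simp: resampler_def view_def resampling_config_def closed_nbhd_def occupation_prob_def)

lemma next_config_expansion:
  assumes "hardcore_model I"
  shows "next_config resampler I (expansion_config I R X) b
       = resampling_config I (exposed_set I R X) X"
proof
  fix v
  show "next_config resampler I (expansion_config I R X) b v
      = resampling_config I (exposed_set I R X) X v"
  proof (cases "v \<in> verts I")
    case v: True
    define s where "s = restrict (expansion_config I R X) (closed_nbhd I v)"
    have s: "s u = \<lparr>spin = u \<in> X, active = u \<in> R, memory = if u \<in> R then 1 else 0\<rparr>"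
      if "u \<in> insert v (neighbours I v)" for u
      using that v neighboursD(1)[OF assms, of u v]
      by (auto simp: s_def closed_nbhd_def expansion_config_def)
    have "next_config resampler I (expansion_config I R X) b v = step resampler (view I v) s
        (restrict b (closed_nbhd I v \<inter> active_set I (expansion_config I R X)))"
      using v by (simp add: next_config_def s_def)
    also have "\<dots> = resampling_config I (exposed_set I R X) X v"
    proof -
      \<comment> \<open>Without memory \<open>2\<close> in sight, \<open>step\<close> takes its
        expansion branch.\<close>
      have "\<not> (\<exists>u\<in>insert v (neighbours I v). memory (s u) = 2)" using s by simp
      moreover have "memory (s v) = 1 \<or> (\<exists>u\<in>neighbours I v. memory (s u) = 1 \<and> spin (s u))
          \<longleftrightarrow> v \<in> exposed_set I R X"
        using s by (auto simp: exposed_set_def)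
      moreover have "spin (s v) \<longleftrightarrow> v \<in> X" using s by simp
      ultimately show ?thesis using v by (simp add: resampler_def view_def resampling_config_def)
    qed
    finally show ?thesis .
  qed (simp add: next_config_def resampling_config_def)
qed

lemma next_config_resampling:
  assumes I: "hardcore_model I" and W: "W \<subseteq> verts I"
    and Y: "Y \<in> independent_sets (remove_vertices I W)" and b: "\<And>v. b v \<Longrightarrow> v \<in> W"
  shows "next_config resampler I (resampling_config I W Y) b
       = expansion_config I (conflicts I (Y \<union> {v. b v})) (Y \<union> {v. b v})"
proof
  fix v
  define X where "X = Y \<union> {v. b v}"
  note Y' = Y[unfolded independent_remove_vertices_iff[OF I]]
  show "next_config resampler I (resampling_config I W Y) b v
      = expansion_config I (conflicts I (Y \<union> {v. b v})) (Y \<union> {v. b v}) v"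
  proof (cases "v \<in> verts I")
    case v: True
    define s where "s = restrict (resampling_config I W Y) (closed_nbhd I v)"
    define b' where "b' = restrict b (closed_nbhd I v \<inter> W)"
    have nb: "u \<in> verts I" if "u \<in> closed_nbhd I v" for u
      using that v neighboursD(1)[OF I] by (auto simp: closed_nbhd_def)
    have mem: "memory (s u) = 2 \<longleftrightarrow> u \<in> W" if "u \<in> closed_nbhd I v" for u
      using that nb[OF that] by (simp add: s_def resampling_config_def)
    have x: "(if active (s u) then b' u else spin (s u)) \<longleftrightarrow> u \<in> X" if "u \<in> closed_nbhd I v" for u
      using that nb[OF that] b[of u] Y' by (auto simp: s_def b'_def resampling_config_def X_def)
    have conf: "v \<in> conflicts I X \<longleftrightarrow> v \<in> X \<and> (\<exists>u\<in>neighbours I v. u \<in> X)"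
      by (auto simp: conflicts_def)
    have next_v: "next_config resampler I (resampling_config I W Y) b v = step resampler (view I v) s b'"
      using v by (simp add: next_config_def active_set_resampling[OF W] s_def b'_def)
    show ?thesis
    proof (cases "\<exists>u\<in>closed_nbhd I v. u \<in> W")
      case True
      then show ?thesis
        unfolding next_v X_def[symmetric]
        using v mem x conf
        by (simp add: resampler_def view_def closed_nbhd_def expansion_config_def Let_def)
    next
      \<comment> \<open>Far from \<open>W\<close>, \<open>v\<close> sees no memory \<open>2\<close>
        and takes the expansion branch. As nothing nearby has memory \<open>1\<close> either, it
        stays idle and keeps its spin, which is right because \<open>Y\<close> has no conflict
        there.\<close>
      case False
      then have "v \<notin> conflicts I X"
        using Y' b unfolding conf by (auto simp: closed_nbhd_def X_def)
      moreover have "v \<in> X \<longleftrightarrow> v \<in> Y" using False b by (auto simp: X_def closed_nbhd_def)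
      ultimately show ?thesis
        unfolding next_v X_def[symmetric]
        using v False neighboursD(1)[OF I, of _ v]
        by (auto simp: resampler_def view_def closed_nbhd_def expansion_config_def Let_def s_def
            resampling_config_def)
    qed
  qed (simp add: next_config_def expansion_config_def)
qed

section \<open>Runs of the algorithm\<close>

lemma run_resampling_empty:
  assumes "Y \<subseteq> verts I"
  shows "run resampler I (resampling_config I {} Y) t c = return_spmf (Y, t, c)"
proof -
  have "occupied I (resampling_config I {} Y) = Y"
    using assms by (auto simp: occupied_def resampling_config_def)
  then show ?thesis by (subst run.simps) (simp add: active_set_resampling)
qed

lemma run_expansion:
  assumes I: "hardcore_model I" and R: "R \<subseteq> verts I"
  shows "run resampler I (expansion_config I R X) t c
    = run resampler I (resampling_config I (exposed_set I R X) X)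
        (t + (if R = {} then 0 else 1)) (c + card R)"
proof (cases "R = {}")
  case True
  \<comment> \<open>With no active vertex the two phases coincide, so no expansion round is
    spent.\<close>
  have "expansion_config I {} X = resampling_config I {} X"
    by (auto simp: expansion_config_def resampling_config_def)
  then show ?thesis using True by simp
next
  case False
  have "finite R" using R I by (auto simp: hardcore_model_def intro: finite_subset)
  then show ?thesis
    using False
    by (subst run.simps)
       (simp add: active_set_expansion[OF R] samplings_expansion[OF R] next_config_expansion[OF I]
         bind_return_pmf)
qed

lemma run_resampling:
  assumes I: "hardcore_model I" and W: "W \<subseteq> verts I" "W \<noteq> {}"
    and Y: "Y \<in> independent_sets (remove_vertices I W)"
  shows "run resampler I (resampling_config I W Y) t c
    = bind_pmf (Pi_pmf W False (\<lambda>v. bernoulli_pmf (occupation_prob I v)))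
        (\<lambda>b. run resampler I (expansion_config I (conflicts I (Y \<union> {v. b v})) (Y \<union> {v. b v}))
               (t + 1) (c + card W))"
proof -
  have fin: "finite W" using W I by (auto simp: hardcore_model_def intro: finite_subset)
  have "run resampler I (resampling_config I W Y) t c
      = bind_pmf (Pi_pmf W False (\<lambda>v. bernoulli_pmf (occupation_prob I v)))
          (\<lambda>b. run resampler I (next_config resampler I (resampling_config I W Y) b)
               (t + 1) (c + card W))"
    using W(2)
    by (subst run.simps) (simp add: active_set_resampling[OF W(1)] samplings_resampling[OF W(1)])
  also have "\<dots> = bind_pmf (Pi_pmf W False (\<lambda>v. bernoulli_pmf (occupation_prob I v)))
        (\<lambda>b. run resampler I (expansion_config I (conflicts I (Y \<union> {v. b v})) (Y \<union> {v. b v}))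
               (t + 1) (c + card W))"
  proof (rule bind_pmf_cong[OF refl])
    fix b assume "b \<in> set_pmf (Pi_pmf W False (\<lambda>v. bernoulli_pmf (occupation_prob I v)))"
    then have "b \<in> PiE_dflt W False (\<lambda>v. set_pmf (bernoulli_pmf (occupation_prob I v)))"
      using set_Pi_pmf_subset'[OF fin, of False "\<lambda>v. bernoulli_pmf (occupation_prob I v)"]
      unfolding o_def by blast
    \<comment> \<open>Bits outside \<open>W\<close> carry the default value
      \<open>False\<close>.\<close>
    then have "v \<in> W" if "b v" for v using that by (auto simp: PiE_dflt_def)
    then show "run resampler I (next_config resampler I (resampling_config I W Y) b) (t + 1) (c + card W)
      = run resampler I (expansion_config I (conflicts I (Y \<union> {v. b v})) (Y \<union> {v. b v}))
               (t + 1) (c + card W)"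
      by (simp add: next_config_resampling[OF I W(1) Y])
  qed
  finally show ?thesis .
qed

text \<open>The invariant as a law of runs: \<open>W\<close> is about to be resampled, and the spins
  off \<open>W\<close> form a Gibbs sample of the remaining graph.\<close>

definition gibbs_run :: "'v hardcore \<Rightarrow> 'v set \<Rightarrow> nat \<Rightarrow> nat \<Rightarrow> ('v set \<times> nat \<times> nat) spmf" where
  "gibbs_run I W t c = bind_pmf (gibbs (remove_vertices I W))
     (\<lambda>Y. run resampler I (resampling_config I W Y) t c)"

lemma gibbs_run_empty:
  assumes "hardcore_model I"
  shows "gibbs_run I {} t c = map_spmf (\<lambda>Y. (Y, t, c)) (spmf_of_pmf (gibbs I))"
proof -
  have "gibbs_run I {} t c = bind_pmf (gibbs I) (\<lambda>Y. return_spmf (Y, t, c))"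
    unfolding gibbs_run_def remove_vertices_empty
    using set_pmf_gibbs_subset[OF assms]
    by (intro bind_pmf_cong refl run_resampling_empty) (auto simp: independent_sets_def)
  then show ?thesis by (simp add: bind_pmf_return_spmf)
qed

lemma set_pmf_next_conflicts_subset:
  assumes "hardcore_model I" "W \<subseteq> verts I"
  shows "set_pmf (next_conflicts I W) \<subseteq> conflicts I ` Pow (verts I)"
  using set_pmf_resampled_subset[OF assms] by (auto simp: next_conflicts_def conflict_free_off_def)

lemma next_conflicts_subset_verts:
  assumes "hardcore_model I" "W \<subseteq> verts I" "B \<in> set_pmf (next_conflicts I W)"
  shows "B \<subseteq> verts I"
  using set_pmf_next_conflicts_subset[OF assms(1,2)] assms(3) by (auto simp: conflicts_def)

lemma resampling_config_Un:
  assumes "B \<inter> verts I \<subseteq> W"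
  shows "resampling_config I W (B \<union> Y) = resampling_config I W Y"
  using assms by (auto simp: resampling_config_def fun_eq_iff restrict_def)

text \<open>Splitting the resampled law by its conflict set restores the invariant, with the closure
  of \<open>B\<close> as the new region. The resampling takes one round with \<open>card W\<close>
  samplings; the expansion takes another with \<open>card B\<close>, unless \<open>B\<close> is
  empty and the run stops.\<close>

lemma gibbs_run_rec:
  assumes I: "hardcore_model I" and W: "W \<subseteq> verts I" "W \<noteq> {}"
  shows "gibbs_run I W t c = bind_pmf (next_conflicts I W)
    (\<lambda>B. gibbs_run I (nbhd_closure I B) (t + (if B = {} then 1 else 2)) (c + card W + card B))"
proof -
  let ?P = "Pi_pmf W False (\<lambda>v. bernoulli_pmf (occupation_prob I v))"
  let ?r = "\<lambda>X. run resampler I (expansion_config I (conflicts I X) X) (t + 1) (c + card W)"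
  have "gibbs_run I W t c = bind_pmf (gibbs (remove_vertices I W)) (\<lambda>Y.
      bind_pmf ?P (\<lambda>b. ?r (Y \<union> {v. b v})))"
    unfolding gibbs_run_def
    using set_pmf_gibbs_subset[OF hardcore_model_remove_vertices[OF I]]
    by (intro bind_pmf_cong refl run_resampling[OF I W]) auto
  also have "\<dots> = bind_pmf (resampled I W) ?r"
    by (simp add: resampled_def bind_assoc_pmf bind_map_pmf)
  also have "\<dots> = bind_pmf (next_conflicts I W) (\<lambda>B.
      bind_pmf (gibbs (remove_vertices I (nbhd_closure I B))) (\<lambda>Y. ?r (B \<union> Y)))"
    by (subst resampled_disintegration[OF I W(1)]) (simp add: bind_assoc_pmf bind_map_pmf)
  also have "\<dots> = bind_pmf (next_conflicts I W)
    (\<lambda>B. gibbs_run I (nbhd_closure I B) (t + (if B = {} then 1 else 2)) (c + card W + card B))"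
  proof (rule bind_pmf_cong[OF refl])
    fix B assume B: "B \<in> set_pmf (next_conflicts I W)"
    have BV: "B \<subseteq> verts I" by (rule next_conflicts_subset_verts[OF I W(1) B])
    obtain X where X: "conflicts I X = B"
      using B set_pmf_next_conflicts_subset[OF I W(1)] by auto
    have BN: "B \<inter> verts I \<subseteq> nbhd_closure I B" by (auto simp: nbhd_closure_def closed_nbhd_def)
    show "bind_pmf (gibbs (remove_vertices I (nbhd_closure I B))) (\<lambda>Y. ?r (B \<union> Y)) =
      gibbs_run I (nbhd_closure I B) (t + (if B = {} then 1 else 2)) (c + card W + card B)"
      unfolding gibbs_run_def
    proof (rule bind_pmf_cong[OF refl])
      fix Y assume "Y \<in> set_pmf (gibbs (remove_vertices I (nbhd_closure I B)))"
      then have "Y \<in> independent_sets (remove_vertices I (nbhd_closure I B))"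
        using set_pmf_gibbs_subset[OF hardcore_model_remove_vertices[OF I]] by blast
      then have "conflicts I (B \<union> Y) = B" by (rule conflicts_union_independent[OF I X])
      then show "?r (B \<union> Y) = run resampler I (resampling_config I (nbhd_closure I B) Y)
          (t + (if B = {} then 1 else 2)) (c + card W + card B)"
        by (simp add: run_expansion[OF I BV] exposed_set_union resampling_config_Un[OF BN])
    qed
  qed
  finally show ?thesis .
qed

section \<open>From the update to the invariant\<close>

text \<open>These are the vertices that notice the update in their own local views; endpoints of
  inserted or deleted edges enter through their neighbourhoods.\<close>

definition changed_vertices :: "'v hardcore \<Rightarrow> 'v hardcore \<Rightarrow> 'v set" where
  "changed_vertices I I' = {v \<in> verts I'. v \<notin> verts I \<or> fugacity I v \<noteq> fugacity I' v \<or>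
                                          neighbours I v \<noteq> neighbours I' v}"

lemma initial_config_resampler:
  assumes "X \<subseteq> verts I"
  shows "initial_config resampler I I' X = expansion_config I' (changed_vertices I I') X"
proof
  fix v
  show "initial_config resampler I I' X v = expansion_config I' (changed_vertices I I') X v"
    using assms
    by (auto simp: initial_config_def expansion_config_def resampler_def view_def closed_nbhd_def
        changed_vertices_def Let_def)
qed

text \<open>Every changed vertex is itself updated or an endpoint of an updated edge; the factor 2
  counts the two endpoints.\<close>

lemma card_changed_vertices_le:
  assumes I: "hardcore_model I" and I': "hardcore_model I'"
  shows "card (changed_vertices I I') \<le> 2 * update_size I I'"
proof -
  have fin: "finite (updated_vertices I I')" "finite (updated_edges I I')"
    using I I' finite_edges[OF I] finite_edges[OF I']
    by (auto simp: updated_vertices_def updated_edges_def hardcore_model_def)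
  have card2: "card e = 2" if "e \<in> updated_edges I I'" for e
    using that I I' by (auto simp: updated_edges_def hardcore_model_def)
  have "changed_vertices I I' \<subseteq> updated_vertices I I' \<union> \<Union> (updated_edges I I')"
  proof
    fix v assume v: "v \<in> changed_vertices I I'"
    show "v \<in> updated_vertices I I' \<union> \<Union> (updated_edges I I')"
    proof (cases "neighbours I v = neighbours I' v")
      case False
      then obtain u where "{u, v} \<in> edges I \<longleftrightarrow> {u, v} \<notin> edges I'" by (auto simp: neighbours_def)
      then have "{u, v} \<in> updated_edges I I'" by (auto simp: updated_edges_def)
      then show ?thesis by blast
    qed (use v in \<open>auto simp: changed_vertices_def updated_vertices_def\<close>)
  qed
  moreover have "finite (\<Union> (updated_edges I I'))"
  proof (rule finite_Union[OF fin(2)])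
    fix e assume "e \<in> updated_edges I I'"
    then show "finite e" by (intro card_ge_0_finite) (simp add: card2)
  qed
  ultimately have "card (changed_vertices I I')
      \<le> card (updated_vertices I I' \<union> \<Union> (updated_edges I I'))"
    using fin(1) by (intro card_mono) auto
  also have "\<dots> \<le> card (updated_vertices I I') + card (\<Union> (updated_edges I I'))"
    by (rule card_Un_le)
  also have "card (\<Union> (updated_edges I I')) \<le> (\<Sum>e\<in>updated_edges I I'. card e)"
    by (rule card_Union_le_sum_card)
  also have "\<dots> = 2 * card (updated_edges I I')" by (simp add: card2)
  finally show ?thesis by (simp add: update_size_def)
qed

text \<open>
  Conditioning the old sample on everything except the unchanged vertices of the new graph leaves
  on those vertices a Gibbs distribution of the new model: all edges and fugacities involved agree.
\<close>

lemma gibbs_update_disintegration: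
  fixes I I' :: "'v hardcore"
  defines "D \<equiv> changed_vertices I I'"
  assumes I: "hardcore_model I" and I': "hardcore_model I'"
  shows "gibbs I = bind_pmf (map_pmf (\<lambda>X. X - (verts I' - D)) (gibbs I))
    (\<lambda>S. map_pmf (\<lambda>Y. S \<union> Y) (gibbs (remove_vertices I' (exposed_set I' D S))))"
proof (rule pmf_disintegration[OF I'])
  show "pmf (gibbs I) X = (if X \<in> independent_sets I
      then 1 / partition_function I * (\<Prod>v\<in>X. fugacity I v) else 0)" for X
    by (simp add: pmf_gibbs[OF I] weight_def)
  show "finite X" if "X \<in> independent_sets I" for X
    using that I by (auto simp: independent_sets_def hardcore_model_def intro: finite_subset)
  have same: "v \<in> verts I" "neighbours I v = neighbours I' v" "fugacity I v = fugacity I' v"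
    if "v \<in> verts I' - D" for v
    using that by (auto simp: D_def changed_vertices_def)
  show "{X' \<in> independent_sets I. X' - (verts I' - D) = X - (verts I' - D)} =
      (\<lambda>Y. X - (verts I' - D) \<union> Y) `
        independent_sets (remove_vertices I' (exposed_set I' D (X - (verts I' - D))))"
    if X: "X \<in> independent_sets I" for X
  proof (intro equalityI subsetI)
    let ?S = "X - (verts I' - D)"
    fix X' assume "X' \<in> {X' \<in> independent_sets I. X' - (verts I' - D) = ?S}"
    then have X': "X' \<in> independent_sets I" "X' - (verts I' - D) = ?S" by auto
    note ind = X'(1)[unfolded independent_iff[OF I]]
    have "X' \<inter> (verts I' - D) \<in> independent_sets (remove_vertices I' (exposed_set I' D ?S))"
      unfolding independent_remove_vertices_iff[OF I']
    proof (intro conjI subsetI ballI)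
      fix v assume v: "v \<in> X' \<inter> (verts I' - D)"
      have "v \<notin> exposed_set I' D ?S"
      proof
        assume "v \<in> exposed_set I' D ?S"
        then obtain u where "u \<in> neighbours I' v" "u \<in> ?S" using v by (auto simp: exposed_set_def)
        then show False using v ind same(2)[of v] X'(2) by blast
      qed
      then show "v \<in> verts I' - exposed_set I' D ?S" using v by blast
    next
      fix v u assume "v \<in> X' \<inter> (verts I' - D)" "u \<in> X' \<inter> (verts I' - D)"
      then show "u \<notin> neighbours I' v" using ind same(2)[of v] by auto
    qed
    moreover have "X' = ?S \<union> (X' \<inter> (verts I' - D))" using X'(2) by blast
    ultimately show "X' \<in> (\<lambda>Y. ?S \<union> Y) `
        independent_sets (remove_vertices I' (exposed_set I' D ?S))" by blast
  next
    let ?S = "X - (verts I' - D)"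
    fix X' assume "X' \<in> (\<lambda>Y. ?S \<union> Y) ` independent_sets (remove_vertices I' (exposed_set I' D ?S))"
    then obtain Y where Y: "Y \<in> independent_sets (remove_vertices I' (exposed_set I' D ?S))"
      and X': "X' = ?S \<union> Y" by auto
    note indY = Y[unfolded independent_remove_vertices_iff[OF I']]
    note indX = X[unfolded independent_iff[OF I]]
    have YD: "Y \<subseteq> verts I' - D" using indY by (auto simp: exposed_set_def)
    have cross: "u \<notin> neighbours I v" if "v \<in> Y" "u \<in> ?S" for u v
    proof
      assume "u \<in> neighbours I v"
      then have u: "u \<in> neighbours I' v" using same(2)[of v] that(1) YD by auto
      \<comment> \<open>\<open>u\<close> is a vertex of the new graph, and \<open>?S\<close>
        contains no unchanged vertex of it.\<close>
      then have "u \<in> D" using neighboursD(1)[OF I' u] that(2) by auto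
      then have "v \<in> exposed_set I' D ?S" using u that(2) by (auto simp: exposed_set_def)
      then show False using indY that(1) by auto
    qed
    have "u \<notin> neighbours I v" if "v \<in> X'" "u \<in> X'" for u v
    proof (cases "v \<in> Y")
      case True
      then show ?thesis
        using that cross indY same(2)[of v] YD unfolding X' by blast
    next
      case False
      then show ?thesis
        using that cross[of u v] indX neighbours_sym[of u I v] unfolding X' by blast
    qed
    moreover have "X' \<subseteq> verts I" using indX YD same(1) unfolding X' by blast
    ultimately have "X' \<in> independent_sets I" unfolding independent_iff[OF I] by blast
    moreover have "X' - (verts I' - D) = ?S" using YD unfolding X' by blast
    ultimately show "X' \<in> {X' \<in> independent_sets I. X' - (verts I' - D) = ?S}" by simp
  qed
  show "(X - (verts I' - D)) \<inter> (verts I' - exposed_set I' D (X - (verts I' - D))) = {}" for X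
    by (auto simp: exposed_set_def)
  show "fugacity I v = fugacity I' v"
    if "v \<in> verts I' - exposed_set I' D (X - (verts I' - D))" for X v
    using that by (intro same(3)) (auto simp: exposed_set_def)
qed

text \<open>\<open>S\<close> is the old sample on the changed and the deleted vertices. Given
  \<open>S\<close>, the initial expansion round brings the run into the invariant; it costs
  \<open>card D\<close> samplings and is skipped when nothing changed.\<close>

lemma dynamic_sample_resampler:
  fixes I I' :: "'v hardcore"
  defines "D \<equiv> changed_vertices I I'"
  assumes I: "hardcore_model I" and I': "hardcore_model I'"
  shows "dynamic_sample resampler I I' =
    bind_pmf (map_pmf (\<lambda>X. X - (verts I' - D)) (gibbs I))
      (\<lambda>S. gibbs_run I' (exposed_set I' D S) (if D = {} then 0 else 1) (card D))"
proof -
  let ?r = "\<lambda>X. run resampler I' (expansion_config I' D X) 0 0"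
  have DV: "D \<subseteq> verts I'" by (auto simp: D_def changed_vertices_def)
  have "dynamic_sample resampler I I' = bind_pmf (gibbs I) ?r"
    unfolding dynamic_sample_def bind_spmf_of_pmf
    using set_pmf_gibbs_subset[OF I]
    by (intro bind_pmf_cong refl) (auto simp: initial_config_resampler independent_sets_def D_def)
  also have "\<dots> = bind_pmf (map_pmf (\<lambda>X. X - (verts I' - D)) (gibbs I)) (\<lambda>S.
      bind_pmf (gibbs (remove_vertices I' (exposed_set I' D S))) (\<lambda>Y. ?r (S \<union> Y)))"
    by (subst gibbs_update_disintegration[OF I I'])
       (simp add: bind_assoc_pmf bind_map_pmf D_def)
  also have "\<dots> = bind_pmf (map_pmf (\<lambda>X. X - (verts I' - D)) (gibbs I))
      (\<lambda>S. gibbs_run I' (exposed_set I' D S) (if D = {} then 0 else 1) (card D))"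
  proof (rule bind_pmf_cong[OF refl])
    fix S assume "S \<in> set_pmf (map_pmf (\<lambda>X. X - (verts I' - D)) (gibbs I))"
    then have S: "S \<inter> verts I' \<subseteq> exposed_set I' D S" by (auto simp: exposed_set_def)
    show "bind_pmf (gibbs (remove_vertices I' (exposed_set I' D S))) (\<lambda>Y. ?r (S \<union> Y)) =
        gibbs_run I' (exposed_set I' D S) (if D = {} then 0 else 1) (card D)"
      unfolding gibbs_run_def
    proof (rule bind_pmf_cong[OF refl])
      fix Y assume "Y \<in> set_pmf (gibbs (remove_vertices I' (exposed_set I' D S)))"
      then have "Y \<in> independent_sets (remove_vertices I' (exposed_set I' D S))"
        using set_pmf_gibbs_subset[OF hardcore_model_remove_vertices[OF I']] by blast
      \<comment> \<open>The region exposed by \<open>D\<close> is thus determined by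
        \<open>S\<close> alone.\<close>
      then have "Y \<inter> D = {}"
        unfolding independent_remove_vertices_iff[OF I'] by (auto simp: exposed_set_def)
      then have "exposed_set I' D (S \<union> Y) = exposed_set I' D S"
        by (auto simp: exposed_set_def)
      then show "?r (S \<union> Y) = run resampler I' (resampling_config I' (exposed_set I' D S) Y)
          (if D = {} then 0 else 1) (card D)"
        by (simp add: run_expansion[OF I' DV] resampling_config_Un[OF S])
    qed
  qed
  finally show ?thesis .
qed

section \<open>Termination, rounds and cost\<close>

context low_fugacity
begin

lemma nbhd_closure_next_conflicts:
  assumes "W \<subseteq> verts I" "B \<in> set_pmf (next_conflicts I W)"
  shows "nbhd_closure I B \<subseteq> verts I"
  using nbhd_closure_subset_verts[OF model next_conflicts_subset_verts[OF model assms]] .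

lemma decay_power_tendsto_0: "(\<lambda>n. a * decay ^ n * b) \<longlonglongrightarrow> 0"
proof -
  have "(\<lambda>n. a * decay ^ n * b) \<longlonglongrightarrow> a * 0 * b"
    using decay_bounds by (intro tendsto_intros LIMSEQ_realpow_zero) auto
  then show ?thesis by simp
qed

lemma potential_contraction_scaled:
  assumes W: "W \<subseteq> verts I" and a: "a \<ge> 0"
  shows "(\<integral>\<^sup>+ B. ennreal (a * potential (nbhd_closure I B)) \<partial>next_conflicts I W)
       \<le> ennreal (a * (decay * potential W))"
proof -
  have "(\<integral>\<^sup>+ B. ennreal (a * potential (nbhd_closure I B)) \<partial>next_conflicts I W)
      = ennreal a * (\<integral>\<^sup>+ B. ennreal (potential (nbhd_closure I B)) \<partial>next_conflicts I W)"
    using a by (simp add: ennreal_mult nn_integral_cmult)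
  also have "\<dots> \<le> ennreal a * ennreal (decay * potential W)"
    by (intro mult_left_mono potential_contraction[OF W]) simp
  finally show ?thesis using a decay_bounds by (simp add: ennreal_mult)
qed

text \<open>Induction on the number \<open>n\<close> of resamplings. Once the region is empty the
  output is exact, and a nonempty region survives \<open>n\<close> resamplings with probability at
  most \<open>decay ^ n * potential W\<close>, which bounds the missing mass.\<close>

lemma pmf_gibbs_le_gibbs_run:
  assumes "W \<subseteq> verts I"
  shows "ennreal (pmf (gibbs I) S)
       \<le> ennreal (spmf (map_spmf fst (gibbs_run I W t c)) S) + ennreal (decay ^ n * potential W)"
  using assms
proof (induction n arbitrary: W t c)
  case 0
  show ?case
  proof (cases "W = {}")
    case True
    then show ?thesis by (simp add: gibbs_run_empty[OF model] pmf.map_comp o_def)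
  next
    case False
    have "ennreal (pmf (gibbs I) S) \<le> ennreal (potential W)"
      using potential_ge_1[OF 0 False] pmf_le_1[of "gibbs I" S] by (intro ennreal_leI) linarith
    then show ?thesis by (simp add: add_increasing)
  qed
next
  case (Suc n)
  show ?case
  proof (cases "W = {}")
    case True
    then show ?thesis by (simp add: gibbs_run_empty[OF model] pmf.map_comp o_def)
  next
    case False
    let ?g = "\<lambda>B. map_spmf fst
      (gibbs_run I (nbhd_closure I B) (t + (if B = {} then 1 else 2)) (c + card W + card B))"
    have "ennreal (pmf (gibbs I) S) = (\<integral>\<^sup>+ B. ennreal (pmf (gibbs I) S) \<partial>next_conflicts I W)"
      by simp
    also have "\<dots> \<le> (\<integral>\<^sup>+ B. ennreal (spmf (?g B) S)
        + ennreal (decay ^ n * potential (nbhd_closure I B)) \<partial>next_conflicts I W)"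
      by (rule nn_integral_mono_AE, unfold AE_measure_pmf_iff, intro ballI Suc.IH
          nbhd_closure_next_conflicts[OF Suc.prems])
    also have "\<dots> = (\<integral>\<^sup>+ B. ennreal (spmf (?g B) S) \<partial>next_conflicts I W)
        + (\<integral>\<^sup>+ B. ennreal (decay ^ n * potential (nbhd_closure I B)) \<partial>next_conflicts I W)"
      by (simp add: nn_integral_add)
    also have "(\<integral>\<^sup>+ B. ennreal (spmf (?g B) S) \<partial>next_conflicts I W)
        = ennreal (spmf (map_spmf fst (gibbs_run I W t c)) S)"
      by (simp add: gibbs_run_rec[OF model Suc.prems False] map_bind_pmf ennreal_pmf_bind)
    also have "(\<integral>\<^sup>+ B. ennreal (decay ^ n * potential (nbhd_closure I B)) \<partial>next_conflicts I W)
        \<le> ennreal (decay ^ n * (decay * potential W))"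
      using decay_bounds by (intro potential_contraction_scaled[OF Suc.prems]) auto
    finally show ?thesis by (simp add: add_left_mono mult_ac)
  qed
qed

text \<open>Letting \<open>n\<close> grow shows that the output dominates the Gibbs distribution
  pointwise, which already forces equality.\<close>

lemma gibbs_run_perfect:
  assumes W: "W \<subseteq> verts I"
  shows "map_spmf fst (gibbs_run I W t c) = spmf_of_pmf (gibbs I)"
proof (rule spmf_eq_spmf_of_pmfI)
  fix S
  let ?s = "spmf (map_spmf fst (gibbs_run I W t c)) S"
  have "pmf (gibbs I) S \<le> ?s + 1 * decay ^ n * potential W" for n
    using pmf_gibbs_le_gibbs_run[OF W, of S t c n] decay_bounds
    by (simp add: ennreal_plus[symmetric] del: ennreal_plus)
  moreover have "(\<lambda>n. ?s + 1 * decay ^ n * potential W) \<longlonglongrightarrow> ?s + 0"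
    by (intro tendsto_add tendsto_const decay_power_tendsto_0)
  ultimately show "pmf (gibbs I) S \<le> ?s"
    using LIMSEQ_le_const[of "\<lambda>n. ?s + 1 * decay ^ n * potential W" "?s + 0"] by auto
qed

text \<open>
  Truncating \<open>h\<close> at \<open>m\<close> bounds the contribution of the runs that are still going after \<open>n\<close>
  resampling rounds by \<open>m\<close> times the probability of that event, which vanishes as \<open>n\<close> grows.
\<close>

lemma gibbs_run_expectation_le:
  fixes h :: "nat \<Rightarrow> nat \<Rightarrow> nat" and \<Psi> :: "'v set \<Rightarrow> nat \<Rightarrow> nat \<Rightarrow> ennreal"
  assumes final: "\<And>t c. of_nat (h t c) \<le> \<Psi> {} t c"
    and super: "\<And>W t c. W \<subseteq> verts I \<Longrightarrow> W \<noteq> {} \<Longrightarrow>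
      (\<integral>\<^sup>+ B. \<Psi> (nbhd_closure I B) (t + (if B = {} then 1 else 2)) (c + card W + card B)
        \<partial>next_conflicts I W) \<le> \<Psi> W t c"
    and W: "W \<subseteq> verts I"
  shows "(\<integral>\<^sup>+ (S, t', c'). of_nat (h t' c') \<partial>measure_spmf (gibbs_run I W t c)) \<le> \<Psi> W t c"
proof -
  define f where "f m = (\<lambda>(S :: 'v set, t', c'). of_nat (min (h t' c') m) :: ennreal)" for m
  have empty: "(\<integral>\<^sup>+ x. f m x \<partial>measure_spmf (gibbs_run I {} t c)) \<le> \<Psi> {} t c" for m t c
  proof -
    have "(\<integral>\<^sup>+ x. f m x \<partial>measure_spmf (gibbs_run I {} t c)) = of_nat (min (h t c) m)"
      by (simp add: gibbs_run_empty[OF model] f_def o_def del: map_spmf_of_pmf)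
    also have "\<dots> \<le> of_nat (h t c)" by (intro of_nat_mono) simp
    finally show ?thesis using final[of t c] by simp
  qed
  have trunc: "(\<integral>\<^sup>+ x. f m x \<partial>measure_spmf (gibbs_run I W t c))
      \<le> \<Psi> W t c + ennreal (real m * decay ^ n * potential W)" if "W \<subseteq> verts I" for m n W t c
    using that
  proof (induction n arbitrary: W t c)
    case 0
    show ?case
    proof (cases "W = {}")
      case True
      then show ?thesis by (simp add: empty)
    next
      case False
      have "(\<integral>\<^sup>+ x. f m x \<partial>measure_spmf (gibbs_run I W t c))
          \<le> (\<integral>\<^sup>+ x. of_nat m \<partial>measure_spmf (gibbs_run I W t c))"
        by (intro nn_integral_mono) (auto simp: f_def)
      also have "\<dots> \<le> of_nat m"
        using mult_left_mono[OF measure_spmf.subprob_emeasure_le_1, of "of_nat m"] by simp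
      also have "\<dots> = ennreal (real m)" by (simp add: ennreal_of_nat_eq_real_of_nat)
      also have "\<dots> \<le> ennreal (real m * potential W)"
        using potential_ge_1[OF 0 False] by (intro ennreal_leI) (simp add: mult_le_cancel_left1)
      finally show ?thesis by (simp add: add_increasing)
    qed
  next
    case (Suc n)
    show ?case
    proof (cases "W = {}")
      case True
      then show ?thesis by (simp add: empty)
    next
      case False
      let ?t = "\<lambda>B. t + (if B = {} then 1 else 2)" and ?c = "\<lambda>B. c + card W + card B"
      have "(\<integral>\<^sup>+ x. f m x \<partial>measure_spmf (gibbs_run I W t c))
          = (\<integral>\<^sup>+ B. (\<integral>\<^sup>+ x. f m x \<partial>measure_spmf (gibbs_run I (nbhd_closure I B) (?t B) (?c B)))
              \<partial>next_conflicts I W)"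
        by (simp add: gibbs_run_rec[OF model Suc.prems False] nn_integral_measure_spmf_bind_pmf)
      also have "\<dots> \<le> (\<integral>\<^sup>+ B. \<Psi> (nbhd_closure I B) (?t B) (?c B)
          + ennreal (real m * decay ^ n * potential (nbhd_closure I B)) \<partial>next_conflicts I W)"
        by (rule nn_integral_mono_AE, unfold AE_measure_pmf_iff, intro ballI Suc.IH
            nbhd_closure_next_conflicts[OF Suc.prems])
      also have "\<dots> = (\<integral>\<^sup>+ B. \<Psi> (nbhd_closure I B) (?t B) (?c B) \<partial>next_conflicts I W)
          + (\<integral>\<^sup>+ B. ennreal (real m * decay ^ n * potential (nbhd_closure I B)) \<partial>next_conflicts I W)"
        by (simp add: nn_integral_add)
      also have "\<dots> \<le> \<Psi> W t c + ennreal (real m * decay ^ n * (decay * potential W))"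
        using decay_bounds
        by (intro add_mono super[OF Suc.prems False] potential_contraction_scaled[OF Suc.prems]) auto
      finally show ?thesis by (simp add: mult_ac)
    qed
  qed
  have bound: "(\<integral>\<^sup>+ x. f m x \<partial>measure_spmf (gibbs_run I W t c)) \<le> \<Psi> W t c" for m
  proof -
    have "(\<lambda>n. ennreal (real m * decay ^ n * potential W)) \<longlonglongrightarrow> ennreal 0"
      by (intro tendsto_ennrealI decay_power_tendsto_0)
    then have "(\<lambda>n. \<Psi> W t c + ennreal (real m * decay ^ n * potential W)) \<longlonglongrightarrow> \<Psi> W t c + ennreal 0"
      by (intro tendsto_add tendsto_const)
    then have "(\<integral>\<^sup>+ x. f m x \<partial>measure_spmf (gibbs_run I W t c)) \<le> \<Psi> W t c + ennreal 0"
      by (rule LIMSEQ_le_const) (use trunc[OF W] in blast)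
    then show ?thesis by simp
  qed
  \<comment> \<open>Monotone convergence in \<open>m\<close> removes the truncation.\<close>
  have "(\<lambda>(S :: 'v set, t', c'). of_nat (h t' c') :: ennreal) = (\<lambda>x. SUP m. f m x)"
  proof
    fix x :: "'v set \<times> nat \<times> nat"
    obtain S t' c' where x: "x = (S, t', c')" by (cases x)
    have "(SUP m. f m x) = of_nat (h t' c')"
    proof (rule antisym)
      show "(SUP m. f m x) \<le> of_nat (h t' c')"
        by (intro SUP_least) (simp add: f_def x)
      show "of_nat (h t' c') \<le> (SUP m. f m x)"
        by (rule SUP_upper2[of "h t' c'"]) (simp_all add: f_def x)
    qed
    then show "(case x of (S, t', c') \<Rightarrow> of_nat (h t' c')) = (SUP m. f m x)" by (simp add: x)
  qed
  then have "(\<integral>\<^sup>+ (S, t', c'). of_nat (h t' c') \<partial>measure_spmf (gibbs_run I W t c))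
      = (\<integral>\<^sup>+ x. (SUP m. f m x) \<partial>measure_spmf (gibbs_run I W t c))"
    by simp
  also have "\<dots> = (SUP m. \<integral>\<^sup>+ x. f m x \<partial>measure_spmf (gibbs_run I W t c))"
    by (rule nn_integral_monotone_convergence_SUP)
       (auto simp: incseq_def le_fun_def f_def intro: min.coboundedI2)
  also have "\<dots> \<le> \<Psi> W t c" by (intro SUP_least bound)
  finally show ?thesis .
qed

text \<open>A step is charged \<open>card W\<close> for the new spins and \<open>card B\<close> for
  the expansion, both bounded by potentials. These charges decay geometrically in expectation,
  whence the factor \<open>2 / (1 - decay)\<close>.\<close>

lemma gibbs_run_cost_le:
  assumes W: "W \<subseteq> verts I"
  shows "(\<integral>\<^sup>+ (S, t', c'). of_nat c' \<partial>measure_spmf (gibbs_run I W t c))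
       \<le> ennreal (real c + 2 / (1 - decay) * potential W)"
proof (rule gibbs_run_expectation_le[where h = "\<lambda>t c. c", OF _ _ W])
  fix t c
  show "of_nat c \<le> ennreal (real c + 2 / (1 - decay) * potential {})"
    by (simp add: ennreal_of_nat_eq_real_of_nat)
next
  fix W t c assume W: "W \<subseteq> verts I" "W \<noteq> {}"
  define L where "L = 2 / (1 - decay)"
  have "1 - decay \<noteq> 0" using decay_bounds by simp
  then have "L * (1 - decay) = 2" using L_def nonzero_eq_divide_eq by blast
  moreover have "L \<ge> 0" using decay_bounds by (simp add: L_def)
  ultimately have L: "L \<ge> 0" "L * (1 - decay) = 2" by simp_all
  have "(\<integral>\<^sup>+ B. ennreal (real (c + card W + card B) + L * potential (nbhd_closure I B))
        \<partial>next_conflicts I W)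
      \<le> (\<integral>\<^sup>+ B. ennreal (real c + real (card W)) + ennreal ((L + 1) * potential (nbhd_closure I B))
        \<partial>next_conflicts I W)"
  proof (rule nn_integral_mono_AE, unfold AE_measure_pmf_iff, intro ballI)
    fix B assume B: "B \<in> set_pmf (next_conflicts I W)"
    have "finite (nbhd_closure I B)"
      using finite_subset[OF nbhd_closure_next_conflicts[OF W(1) B] finite_verts] .
    then have "card B \<le> card (nbhd_closure I B)"
      by (intro card_mono) (auto simp: nbhd_closure_iff)
    then have "real (card B) \<le> potential (nbhd_closure I B)"
      using potential_bounds(1)[of "nbhd_closure I B"] by linarith
    then show "ennreal (real (c + card W + card B) + L * potential (nbhd_closure I B))
        \<le> ennreal (real c + real (card W)) + ennreal ((L + 1) * potential (nbhd_closure I B))"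
      using L(1) by (subst ennreal_plus[symmetric]) (auto intro!: ennreal_leI simp: algebra_simps simp del: ennreal_plus)
  qed
  also have "\<dots> = ennreal (real c + real (card W))
      + (\<integral>\<^sup>+ B. ennreal ((L + 1) * potential (nbhd_closure I B)) \<partial>next_conflicts I W)"
    by (simp add: nn_integral_add)
  also have "\<dots> \<le> ennreal (real c + real (card W)) + ennreal ((L + 1) * (decay * potential W))"
    using L(1) by (intro add_left_mono potential_contraction_scaled[OF W(1)]) auto
  also have "\<dots> = ennreal (real c + real (card W) + (L + 1) * (decay * potential W))"
    using L(1) decay_bounds by (intro ennreal_plus[symmetric]) auto
  also have "\<dots> \<le> ennreal (real c + L * potential W)"
  proof (rule ennreal_leI)
    \<comment> \<open>This amounts to \<open>1 + decay \<le> L * (1 - decay)\<close>, and the right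
      side is 2.\<close>
    have "(1 + (L + 1) * decay) * potential W \<le> L * potential W"
      using L(2) decay_bounds by (intro mult_right_mono) (auto simp: algebra_simps)
    then show "real c + real (card W) + (L + 1) * (decay * potential W) \<le> real c + L * potential W"
      using potential_bounds(1)[of W] by (simp add: algebra_simps)
  qed
  finally show "(\<integral>\<^sup>+ B. ennreal (real (c + card W + card B)
        + 2 / (1 - decay) * potential (nbhd_closure I B)) \<partial>next_conflicts I W)
      \<le> ennreal (real c + 2 / (1 - decay) * potential W)"
    by (simp add: L_def)
qed

text \<open>A step uses at most two rounds, while the contraction is worth \<open>- ln decay\<close>
  on the logarithmic scale; the quotient is the number of rounds paid per unit of logarithm.\<close>

definition round_rate :: real where
  "round_rate = 2 / - ln decay"

text \<open>The summand \<open>round_rate\<close> offsets the \<open>-1\<close> in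
  \<open>ln y \<le> y - 1\<close>, and the \<open>2\<close> keeps the tangent nonnegative at the
  empty region.\<close>

definition round_potential :: "'v set \<Rightarrow> real" where
  "round_potential W = (if W = {} then 0 else 2 + round_rate + round_rate * ln (potential W))"

lemma round_rate_bounds: "round_rate > 0" "round_rate * - ln decay = 2"
  using decay_bounds by (auto simp: round_rate_def ln_less_zero_iff divide_neg_neg field_simps)

lemma round_potential_nonneg: "W \<subseteq> verts I \<Longrightarrow> 0 \<le> round_potential W"
  using potential_ge_1[of W] round_rate_bounds(1) by (auto simp: round_potential_def)

text \<open>
  The logarithm is replaced by its tangent at \<open>decay * potential W\<close>, to which the contraction
  applies.
\<close>

lemma round_potential_decrease:
  assumes W: "W \<subseteq> verts I" "W \<noteq> {}"
  shows "(\<integral>\<^sup>+ B. ennreal (round_potential (nbhd_closure I B)) \<partial>next_conflicts I W) + 2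
       \<le> ennreal (round_potential W)"
proof -
  define b x where "b = round_rate" and "x = decay * potential W"
  \<comment> \<open>The intercept at potential 0 of the tangent taken at \<open>x\<close>. It must
    be nonnegative to cover the empty region, whose round potential is 0.\<close>
  define a where "a = 2 + b * ln x"
  have pos: "x > 0" using decay_bounds potential_ge_1[OF W] by (simp add: x_def)
  have b: "b > 0" "b * - ln decay = 2" unfolding b_def by (rule round_rate_bounds)+
  have lnx: "ln x = ln decay + ln (potential W)"
    using decay_bounds potential_ge_1[OF W] unfolding x_def by (intro ln_mult_pos) auto
  have "b * ln (potential W) \<ge> 0" using b potential_ge_1[OF W] by simp
  then have a: "a \<ge> 0" using b(2) by (simp add: a_def lnx algebra_simps)
  have "(\<integral>\<^sup>+ B. ennreal (round_potential (nbhd_closure I B)) \<partial>next_conflicts I W)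
      \<le> (\<integral>\<^sup>+ B. ennreal a + ennreal (b / x * potential (nbhd_closure I B)) \<partial>next_conflicts I W)"
  proof (rule nn_integral_mono_AE, unfold AE_measure_pmf_iff, intro ballI)
    fix B assume B: "B \<in> set_pmf (next_conflicts I W)"
    let ?N = "nbhd_closure I B"
    have "round_potential ?N \<le> a + b / x * potential ?N"
    proof (cases "?N = {}")
      case True
      then show ?thesis using a by (simp add: round_potential_def)
    next
      case False
      have "potential ?N \<ge> 1" by (rule potential_ge_1[OF nbhd_closure_next_conflicts[OF W(1) B] False])
      then have "ln (potential ?N / x) = ln (potential ?N) - ln x"
        using pos by (intro ln_divide_pos) auto
      moreover have "ln (potential ?N / x) \<le> potential ?N / x - 1"
        using pos \<open>potential ?N \<ge> 1\<close> by (intro ln_le_minus_one) auto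
      ultimately have "ln (potential ?N) \<le> ln x + potential ?N / x - 1" by simp
      then have "b * ln (potential ?N) \<le> b * (ln x + potential ?N / x - 1)"
        using b by (intro mult_left_mono) auto
      then show ?thesis
        using False by (simp add: round_potential_def a_def b_def[symmetric] algebra_simps)
    qed
    then show "ennreal (round_potential ?N) \<le> ennreal a + ennreal (b / x * potential ?N)"
      using a b pos by (subst ennreal_plus[symmetric]) (auto intro!: ennreal_leI simp del: ennreal_plus)
  qed
  also have "\<dots> = ennreal a + (\<integral>\<^sup>+ B. ennreal (b / x * potential (nbhd_closure I B)) \<partial>next_conflicts I W)"
    by (simp add: nn_integral_add)
  also have "\<dots> \<le> ennreal a + ennreal (b / x * (decay * potential W))"
    using b pos by (intro add_left_mono potential_contraction_scaled[OF W(1)]) auto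
  also have "b / x * (decay * potential W) = b" using pos by (simp add: x_def[symmetric])
  finally have "(\<integral>\<^sup>+ B. ennreal (round_potential (nbhd_closure I B)) \<partial>next_conflicts I W) + 2
      \<le> ennreal a + ennreal b + 2"
    by (intro add_right_mono)
  also have "\<dots> = ennreal (a + b + 2)"
    using a b by (simp add: ennreal_plus[symmetric] ennreal_numeral[symmetric] del: ennreal_plus ennreal_numeral)
  also have "a + b + 2 = round_potential W"
    using W(2) b(2) by (simp add: round_potential_def a_def lnx b_def[symmetric] algebra_simps)
  finally show ?thesis .
qed

text \<open>Every step, the last one included, is charged two rounds.\<close>

lemma gibbs_run_rounds_le:
  assumes W: "W \<subseteq> verts I"
  shows "(\<integral>\<^sup>+ (S, t', c'). of_nat t' \<partial>measure_spmf (gibbs_run I W t c))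
       \<le> of_nat t + ennreal (round_potential W)"
proof (rule gibbs_run_expectation_le[where h = "\<lambda>t c. t", OF _ _ W])
  fix W t c assume W: "W \<subseteq> verts I" "W \<noteq> {}"
  have "(\<integral>\<^sup>+ B. of_nat (t + (if B = {} then 1 else 2))
        + ennreal (round_potential (nbhd_closure I B)) \<partial>next_conflicts I W)
      \<le> (\<integral>\<^sup>+ B. of_nat (t + 2) + ennreal (round_potential (nbhd_closure I B)) \<partial>next_conflicts I W)"
    by (intro nn_integral_mono add_right_mono of_nat_mono) simp
  also have "\<dots> = of_nat t
      + ((\<integral>\<^sup>+ B. ennreal (round_potential (nbhd_closure I B)) \<partial>next_conflicts I W) + 2)"
    by (simp add: nn_integral_add add_ac)
  also have "\<dots> \<le> of_nat t + ennreal (round_potential W)"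
    by (intro add_left_mono round_potential_decrease[OF W])
  finally show "(\<integral>\<^sup>+ B. of_nat (t + (if B = {} then 1 else 2))
        + ennreal (round_potential (nbhd_closure I B)) \<partial>next_conflicts I W)
      \<le> of_nat t + ennreal (round_potential W)" .
qed simp

end

section \<open>Bounds for one update, with degree and fugacities restricted after it\<close>

locale dynamic_hardcore = low_fugacity I' \<Delta> for I' :: "'v hardcore" and \<Delta> +
  fixes I :: "'v hardcore"
  assumes model_old: "hardcore_model I"
begin

abbreviation D :: "'v set" where
  "D \<equiv> changed_vertices I I'"

lemma exposed_changed_subset: "exposed_set I' D S \<subseteq> verts I'"
  by (rule subset_trans[OF exposed_set_subset_nbhd_closure nbhd_closure_subset_verts[OF model]])
     (auto simp: changed_vertices_def)

text \<open>The constant is 2 for potential against size, times \<open>\<Delta> + 1\<close> for a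
  closed neighbourhood, times 2 for changed vertices against update size.\<close>

lemma potential_exposed_changed_le:
  "potential (exposed_set I' D S) \<le> 4 * (real \<Delta> + 1) * real (update_size I I')"
proof -
  have DV: "D \<subseteq> verts I'" by (auto simp: changed_vertices_def)
  have "card (exposed_set I' D S) \<le> card (nbhd_closure I' D)"
    using finite_subset[OF nbhd_closure_subset_verts[OF model DV] finite_verts]
    by (intro card_mono exposed_set_subset_nbhd_closure)
  also have "\<dots> \<le> (\<Delta> + 1) * card D"
    by (rule card_nbhd_closure_le[OF model DV card_neighbours_le])
  also have "\<dots> \<le> (\<Delta> + 1) * (2 * update_size I I')"
    by (intro mult_left_mono card_changed_vertices_le[OF model_old model]) simp
  finally have "real (card (exposed_set I' D S)) \<le> real ((\<Delta> + 1) * (2 * update_size I I'))"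
    by (rule of_nat_mono)
  then show ?thesis
    using potential_bounds(2)[of "exposed_set I' D S"] by (simp add: algebra_simps)
qed

lemma returns_perfect_sample_resampler: "returns_perfect_sample resampler I I'"
  unfolding returns_perfect_sample_def dynamic_sample_resampler[OF model_old model]
  by (simp add: map_bind_pmf gibbs_run_perfect[OF exposed_changed_subset])

text \<open>The 3 is the initial expansion round plus the 2 from \<open>round_potential\<close>. The
  \<open>+ 1\<close> inside the logarithm keeps it nonnegative for an empty update.\<close>

lemma expected_rounds_resampler_le:
  "expected_rounds resampler I I' \<le> ennreal (3 + round_rate
     + round_rate * ln (4 * (real \<Delta> + 1) * real (update_size I I') + 1))"
proof -
  have "expected_rounds resampler I I' \<le> (\<integral>\<^sup>+ S. ennreal (3 + round_rate
     + round_rate * ln (4 * (real \<Delta> + 1) * real (update_size I I') + 1))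
      \<partial>map_pmf (\<lambda>X. X - (verts I' - D)) (gibbs I))"
    unfolding expected_rounds_def dynamic_sample_resampler[OF model_old model]
      nn_integral_measure_spmf_bind_pmf
  proof (rule nn_integral_mono)
    fix S
    let ?W = "exposed_set I' D S"
    have "(\<integral>\<^sup>+ (S, t, c). of_nat t \<partial>measure_spmf
          (gibbs_run I' ?W (if D = {} then 0 else 1) (card D)))
        \<le> of_nat (if D = {} then 0 else 1) + ennreal (round_potential ?W)"
      by (rule gibbs_run_rounds_le[OF exposed_changed_subset])
    also have "\<dots> \<le> of_nat 1 + ennreal (round_potential ?W)"
      by (intro add_right_mono of_nat_mono) simp
    also have "\<dots> = ennreal (1 + round_potential ?W)"
      using round_potential_nonneg[OF exposed_changed_subset] by simp
    also have "\<dots> \<le> ennreal (3 + round_rate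
        + round_rate * ln (4 * (real \<Delta> + 1) * real (update_size I I') + 1))"
    proof (rule ennreal_leI, cases "?W = {}")
      case True
      have "0 \<le> round_rate * ln (4 * (real \<Delta> + 1) * real (update_size I I') + 1)"
        using round_rate_bounds(1) by simp
      then show "1 + round_potential ?W \<le> 3 + round_rate
          + round_rate * ln (4 * (real \<Delta> + 1) * real (update_size I I') + 1)"
        using True round_rate_bounds(1) by (simp add: round_potential_def)
    next
      case False
      have "ln (potential ?W) \<le> ln (4 * (real \<Delta> + 1) * real (update_size I I') + 1)"
        using potential_ge_1[OF exposed_changed_subset False] potential_exposed_changed_le[of S]
        by (intro ln_mono) auto
      then show "1 + round_potential ?W \<le> 3 + round_rate
          + round_rate * ln (4 * (real \<Delta> + 1) * real (update_size I I') + 1)"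
        using False round_rate_bounds(1) by (simp add: round_potential_def mult_left_mono)
    qed
    finally show "(\<integral>\<^sup>+ (S, t, c). of_nat t \<partial>measure_spmf
          (gibbs_run I' ?W (if D = {} then 0 else 1) (card D)))
        \<le> ennreal (3 + round_rate
        + round_rate * ln (4 * (real \<Delta> + 1) * real (update_size I I') + 1))" .
  qed
  then show ?thesis by simp
qed

text \<open>The first summand pays for the initial expansion round, the second for the resampling
  that follows.\<close>

lemma expected_cost_resampler_le:
  "expected_cost resampler I I' \<le> ennreal
     ((2 + 2 / (1 - decay) * (4 * (real \<Delta> + 1))) * real (update_size I I'))"
proof -
  let ?K = "(2 + 2 / (1 - decay) * (4 * (real \<Delta> + 1))) * real (update_size I I')"
  have "expected_cost resampler I I'
      \<le> (\<integral>\<^sup>+ S. ennreal ?K \<partial>map_pmf (\<lambda>X. X - (verts I' - D)) (gibbs I))"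
    unfolding expected_cost_def dynamic_sample_resampler[OF model_old model]
      nn_integral_measure_spmf_bind_pmf
  proof (rule nn_integral_mono)
    fix S
    let ?W = "exposed_set I' D S"
    have "(\<integral>\<^sup>+ (S, t, c). of_nat c \<partial>measure_spmf
          (gibbs_run I' ?W (if D = {} then 0 else 1) (card D)))
        \<le> ennreal (real (card D) + 2 / (1 - decay) * potential ?W)"
      by (rule gibbs_run_cost_le[OF exposed_changed_subset])
    also have "\<dots> \<le> ennreal (real (2 * update_size I I')
        + 2 / (1 - decay) * (4 * (real \<Delta> + 1) * real (update_size I I')))"
      using decay_bounds
      by (intro ennreal_leI add_mono of_nat_mono mult_left_mono potential_exposed_changed_le
          card_changed_vertices_le[OF model_old model]) auto
    also have "\<dots> = ennreal ?K" by (simp add: algebra_simps)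
    finally show "(\<integral>\<^sup>+ (S, t, c). of_nat c \<partial>measure_spmf
          (gibbs_run I' ?W (if D = {} then 0 else 1) (card D))) \<le> ennreal ?K" .
  qed
  then show ?thesis by simp
qed

end

text \<open>From \<open>k = 3\<close> on, \<open>ln k\<close> is at least 1 and absorbs additive
  constants, while \<open>c * k + 1\<close> is at most \<open>(c + 1) * k\<close>.\<close>

lemma affine_ln_bigo:
  fixes a b c :: real
  assumes "c > 0"
  shows "(\<lambda>k. a + b * ln (c * real k + 1)) \<in> O(\<lambda>k. ln (real k))"
proof -
  have ln_bigo: "(\<lambda>k. ln (c * real k + 1)) \<in> O(\<lambda>k. ln (real k))"
  proof (rule bigoI)
    show "eventually (\<lambda>k. norm (ln (c * real k + 1)) \<le> (ln (c + 1) + 1) * norm (ln (real k))) sequentially"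
      using eventually_ge_at_top[of 3]
    proof eventually_elim
      case (elim k)
      have "exp 1 \<le> real k" using exp_le elim by linarith
      then have ln1: "1 \<le> ln (real k)" using elim by (subst ln_ge_iff) auto
      have "ln (c * real k + 1) \<le> ln ((c + 1) * real k)"
        using assms elim by (intro ln_mono) (auto simp: algebra_simps add_pos_nonneg)
      also have "\<dots> = ln (c + 1) + ln (real k)" using assms elim by (intro ln_mult_pos) auto
      also have "\<dots> \<le> ln (c + 1) * ln (real k) + ln (real k)"
        using assms ln1 mult_left_mono[OF ln1, of "ln (c + 1)"] by simp
      finally show ?case
        using assms ln1 by (simp add: algebra_simps)
    qed
  qed
  have "(\<lambda>k. a) \<in> O(\<lambda>k. ln (real k))"
  proof (rule bigoI)
    show "eventually (\<lambda>k. norm a \<le> norm a * norm (ln (real k))) sequentially"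
      using eventually_ge_at_top[of 3]
    proof eventually_elim
      case (elim k)
      have "exp 1 \<le> real k" using exp_le elim by linarith
      then have ln1: "1 \<le> ln (real k)" using elim by (subst ln_ge_iff) auto
      then show ?case using mult_left_mono[OF ln1, of "norm a"] by simp
    qed
  qed
  then show ?thesis using ln_bigo by (intro sum_in_bigo landau_o.big.cmult_in_iff') simp_all
qed

theorem theorem4:
  shows "\<exists>A :: 'v algorithm. \<forall>\<Delta> :: nat. \<exists>T C :: nat \<Rightarrow> real.
    T \<in> O(\<lambda>k. ln (real k)) \<and> C \<in> O(\<lambda>k. real k) \<and>
    (\<forall>I I' :: 'v hardcore.
       hardcore_model I \<longrightarrow> hardcore_model I' \<longrightarrow>
       max_degree I' \<le> \<Delta> \<longrightarrow>
       (\<forall>v\<in>verts I'. fugacity I' v \<le> 1 / (sqrt 2 * real \<Delta> - 1)) \<longrightarrow>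
       returns_perfect_sample A I I' \<and>
       expected_rounds A I I' \<le> ennreal (T (update_size I I')) \<and>
       expected_cost A I I' \<le> ennreal (C (update_size I I')))"
proof (intro exI[of _ resampler] allI)
  fix \<Delta> :: nat
  \<comment> \<open>These locale constants depend on \<open>\<Delta>\<close> alone, so
    \<open>?T\<close> and \<open>?C\<close> are fixed before the two models.\<close>
  let ?b = "low_fugacity.round_rate \<Delta>" and ?d = "low_fugacity.decay \<Delta>"
  let ?T = "\<lambda>k. (3 + ?b) + ?b * ln (4 * (real \<Delta> + 1) * real k + 1)"
  let ?C = "\<lambda>k. (2 + 2 / (1 - ?d) * (4 * (real \<Delta> + 1))) * real k"
  show "\<exists>T C :: nat \<Rightarrow> real.
    T \<in> O(\<lambda>k. ln (real k)) \<and> C \<in> O(\<lambda>k. real k) \<and>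
    (\<forall>I I' :: 'v hardcore.
       hardcore_model I \<longrightarrow> hardcore_model I' \<longrightarrow>
       max_degree I' \<le> \<Delta> \<longrightarrow>
       (\<forall>v\<in>verts I'. fugacity I' v \<le> 1 / (sqrt 2 * real \<Delta> - 1)) \<longrightarrow>
       returns_perfect_sample resampler I I' \<and>
       expected_rounds resampler I I' \<le> ennreal (T (update_size I I')) \<and>
       expected_cost resampler I I' \<le> ennreal (C (update_size I I')))"
  proof (rule exI[of _ ?T], rule exI[of _ ?C], intro conjI allI impI)
    show "?T \<in> O(\<lambda>k. ln (real k))" by (rule affine_ln_bigo) simp
    show "?C \<in> O(\<lambda>k. real k)" by simp
    fix I I' :: "'v hardcore"
    assume "hardcore_model I" "hardcore_model I'" "max_degree I' \<le> \<Delta>"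
      "\<forall>v\<in>verts I'. fugacity I' v \<le> 1 / (sqrt 2 * real \<Delta> - 1)"
    then interpret dynamic_hardcore I' \<Delta> I by unfold_locales auto
    show "returns_perfect_sample resampler I I'" by (rule returns_perfect_sample_resampler)
    show "expected_rounds resampler I I' \<le> ennreal (?T (update_size I I'))"
      by (rule expected_rounds_resampler_le)
    show "expected_cost resampler I I' \<le> ennreal (?C (update_size I I'))"
      by (rule expected_cost_resampler_le)
  qed
qed

end
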